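(* Suppose $(C_t)$ is a counting process on $[0,1]$ for which there exists a random time $\mathcal T$ such that the confined process $(C_t)_{\mathcal T<t\le 1}$ has independent increments according to a predictable (non-random) intensity measure $\eta(t)_{\mathcal T<t\le 1}$. Suppose that $\eta(t)$ is Riemann integrable on $[0,1]$ and that $E(C_1)<\infty$. Then the optimal strategy to stop on the last jump time of $(C_t)$ (when stopping is not allowed before time $\mathcal T$) is to select, if it exists, the first arrival time $\tau\ge\mathcal T$ with $\tau$ satisfying $$E(C_1-C_\tau)=\int_\tau^1\eta(u)\,du\le 1.$$
   Context: The arrival times of the counting process $(C_t)$ are its jump times. That the confined process has intensity $\eta$ means that the expected number of jumps of $(C_t)$ in a subinterval $[a,b[$ of $[\mathcal T,1]$ is $\int_a^b\eta(u)\,du$; the intensity is non-random from time $\mathcal T$ onwards. Accordingly, $E(C_1-C_\tau)$ denotes the expected number of jumps from $\tau$ to $1$, i.e. the integral of $\eta$ from $\tau$ to $1$. The process is observed sequentially in time, one stops online (only one stop, without recall), and stopping is not allowed before the random time $\mathcal T$. Optimal means maximizing the probability of stopping on the last jump time of $(C_t)$ in $[0,1]$. *)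

theory Defs
  imports "HOL-Probability.Probability"
begin

text \<open>
  Time is the interval \<open>[0, 1]\<close> inside \<open>real\<close>. The library notions of filtration and stopping time
  require a whole type as index set; a filtration on \<open>[0, 1]\<close> is regarded as one on \<open>real\<close>; only
  its members with index in \<open>[0, 1]\<close> carry meaning (extend it constantly outside).
\<close>

text \<open>A constant gauge: the Riemann sums converge as the mesh tends to 0. (The library's
  \<open>integrable_on\<close> is the more general gauge integral, whose value agrees with the Riemann integral
  when the latter exists.)\<close>

definition Riemann_integrable_on :: "(real \<Rightarrow> real) \<Rightarrow> real \<Rightarrow> real \<Rightarrow> bool" where
  "Riemann_integrable_on f a b \<longleftrightarrow>
     (\<exists>I. \<forall>e>0. \<exists>d>0. \<forall>p. p tagged_division_of {a..b} \<and> (\<lambda>x. ball x d) fine p \<longrightarrow>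
        \<bar>(\<Sum>(x, K)\<in>p. measure lborel K * f x) - I\<bar> < e)"

definition counting_process ::
  "(real \<Rightarrow> 'a measure) \<Rightarrow> 'a set \<Rightarrow> (real \<Rightarrow> 'a \<Rightarrow> nat) \<Rightarrow> bool" where
  "counting_process F \<Omega> C \<longleftrightarrow>
     (\<forall>t\<in>{0..1}. C t \<in> F t \<rightarrow>\<^sub>M count_space UNIV) \<and>
     (\<forall>\<omega>\<in>\<Omega>. C 0 \<omega> = 0 \<and>
        mono_on {0..1} (\<lambda>t. C t \<omega>) \<and>
        (\<forall>t\<in>{0..<1}. continuous (at_right t) (\<lambda>u. real (C u \<omega>))) \<and>
        (\<forall>t\<in>{0<..1}. \<exists>l. ((\<lambda>u. real (C u \<omega>)) \<longlongrightarrow> l) (at_left t) \<and> real (C t \<omega>) - l \<in> {0, 1}))"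

definition arrival_time :: "(real \<Rightarrow> 'a \<Rightarrow> nat) \<Rightarrow> 'a \<Rightarrow> real \<Rightarrow> bool" where
  "arrival_time C \<omega> t \<longleftrightarrow>
     t \<in> {0..1} \<and> \<not> continuous (at t within {0..1}) (\<lambda>u. real (C u \<omega>))"

text \<open>
  Since \<open>T\<close> is random, the confined process is described through conditioning on
  \<open>{T \<le> s}\<close>, i.e. on the event that the confined process has started by time \<open>s\<close>: under this
  conditional probability the increment over \<open>(s, t]\<close> is independent of everything observed up to
  \<open>s\<close>, and its expectation is the integral of the deterministic function \<open>\<eta>\<close>. Neither condition
  involves a possible jump at \<open>T\<close> itself. The subtraction is on \<open>nat\<close>, but \<open>C s \<omega> \<le> C t \<omega>\<close>.
\<close>

definition given_started :: "'a measure \<Rightarrow> ('a \<Rightarrow> real) \<Rightarrow> real \<Rightarrow> 'a measure" where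
  "given_started M T s = uniform_measure M {\<omega> \<in> space M. T \<omega> \<le> s}"

definition confined_independent_increments ::
  "'a measure \<Rightarrow> (real \<Rightarrow> 'a measure) \<Rightarrow> (real \<Rightarrow> 'a \<Rightarrow> nat) \<Rightarrow> ('a \<Rightarrow> real) \<Rightarrow> bool" where
  "confined_independent_increments M F C T \<longleftrightarrow>
     (\<forall>s t. 0 \<le> s \<and> s \<le> t \<and> t \<le> 1 \<and> measure M {\<omega> \<in> space M. T \<omega> \<le> s} > 0 \<longrightarrow>
        prob_space.indep_set (given_started M T s)
          (sets (F s)) {(\<lambda>\<omega>. C t \<omega> - C s \<omega>) -` B \<inter> space M | B. True})"

definition confined_intensity ::
  "'a measure \<Rightarrow> (real \<Rightarrow> 'a \<Rightarrow> nat) \<Rightarrow> ('a \<Rightarrow> real) \<Rightarrow> (real \<Rightarrow> real) \<Rightarrow> bool" where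
  "confined_intensity M C T \<eta> \<longleftrightarrow>
     (\<forall>t\<in>{0..1}. 0 \<le> \<eta> t) \<and>
     (\<forall>s t. 0 \<le> s \<and> s \<le> t \<and> t \<le> 1 \<and> measure M {\<omega> \<in> space M. T \<omega> \<le> s} > 0 \<longrightarrow>
        (\<integral>\<omega>. real (C t \<omega> - C s \<omega>) \<partial>given_started M T s) = integral {s..t} \<eta>)"

text \<open>The value 2, lying outside the time interval, encodes that one does not stop at all.\<close>

definition no_stop :: real where
  "no_stop = 2"

definition admissible_strategy ::
  "(real \<Rightarrow> 'a measure) \<Rightarrow> 'a set \<Rightarrow> ('a \<Rightarrow> real) \<Rightarrow> ('a \<Rightarrow> real) \<Rightarrow> bool" where
  "admissible_strategy F \<Omega> T \<sigma> \<longleftrightarrow>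
     stopping_time F \<sigma> \<and> (\<forall>\<omega>\<in>\<Omega>. \<sigma> \<omega> \<in> {T \<omega>..1} \<union> {no_stop})"

definition success_event :: "'a set \<Rightarrow> (real \<Rightarrow> 'a \<Rightarrow> nat) \<Rightarrow> ('a \<Rightarrow> real) \<Rightarrow> 'a set" where
  "success_event \<Omega> C \<sigma> =
     {\<omega> \<in> \<Omega>. arrival_time C \<omega> (\<sigma> \<omega>) \<and> (\<forall>u. arrival_time C \<omega> u \<longrightarrow> u \<le> \<sigma> \<omega>)}"

definition optimal_strategy ::
  "'a measure \<Rightarrow> (real \<Rightarrow> 'a measure) \<Rightarrow> (real \<Rightarrow> 'a \<Rightarrow> nat) \<Rightarrow> ('a \<Rightarrow> real) \<Rightarrow> ('a \<Rightarrow> real) \<Rightarrow> bool" where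
  "optimal_strategy M F C T \<sigma> \<longleftrightarrow>
     admissible_strategy F (space M) T \<sigma> \<and>
     success_event (space M) C \<sigma> \<in> sets M \<and>
     (\<forall>\<sigma>'. admissible_strategy F (space M) T \<sigma>' \<longrightarrow>
        success_event (space M) C \<sigma>' \<in> sets M \<and>
        measure M (success_event (space M) C \<sigma>') \<le> measure M (success_event (space M) C \<sigma>))"

definition selectable_arrival ::
  "(real \<Rightarrow> 'a \<Rightarrow> nat) \<Rightarrow> ('a \<Rightarrow> real) \<Rightarrow> (real \<Rightarrow> real) \<Rightarrow> 'a \<Rightarrow> real \<Rightarrow> bool" where
  "selectable_arrival C T \<eta> \<omega> t \<longleftrightarrow>
     arrival_time C \<omega> t \<and> T \<omega> \<le> t \<and> integral {t..1} \<eta> \<le> 1"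

text \<open>Paths have finitely many jumps, so the least element exists as soon as there is a
  selectable arrival.\<close>

definition first_selectable_arrival ::
  "(real \<Rightarrow> 'a \<Rightarrow> nat) \<Rightarrow> ('a \<Rightarrow> real) \<Rightarrow> (real \<Rightarrow> real) \<Rightarrow> 'a \<Rightarrow> real" where
  "first_selectable_arrival C T \<eta> \<omega> =
     (if \<exists>t. selectable_arrival C T \<eta> \<omega> t then LEAST t. selectable_arrival C T \<eta> \<omega> t else no_stop)"

end

theory Submission
  imports Defs
begin

text \<open>
  Let \<open>m s\<close> be the integral of \<open>\<eta>\<close> over \<open>[s, 1]\<close>, \<open>r\<close> the first time with \<open>m r \<le> 1\<close>, \<open>\<tau>\<close> the
  first selectable arrival, and \<open>L\<close> the last arrival. The comparison rests on one identity
  (lemma \<open>one_arrival_vs_none\<close>): on an event known at time \<open>s\<close> on which the confined process has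
  started,
  \<open>P(exactly one arrival after s) = m s * P(no arrival after s)\<close>, as for a Poisson
  variable with mean \<open>m s\<close>. It comes from cutting \<open>[s, 1]\<close> into \<open>n\<close> cells: if cell \<open>k\<close> is occupied
  with probability \<open>p\<^sub>k\<close>, independence gives
  \<open>P(only cell k occupied) * (1 - p\<^sub>k) = p\<^sub>k * P(no cell occupied)\<close>. Jumps have size one, so for fine
  grids the number of occupied cells is the number of arrivals; hence \<open>\<Sum>p\<^sub>k\<close> tends to the mean
  \<open>m s\<close>, and summing over \<open>k\<close> yields the identity in the limit.

  Now compare an arbitrary strategy \<open>\<sigma>\<close> with \<open>\<tau>\<close>.

  \<^item> If \<open>\<sigma>\<close> succeeds before \<open>r\<close>, then there is no arrival after \<open>r\<close>. Since \<open>m r = 1\<close>, on the event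
    \<open>\<sigma> < r\<close> exactly one arrival after \<open>r\<close> is as likely as none, and if there is exactly one then \<open>\<tau>\<close>
    succeeds, up to the null event of an arrival at \<open>r\<close> itself
    (\<open>stopping_before_threshold_no_gain\<close>).

  \<^item> If \<open>\<sigma>\<close> succeeds at or after \<open>r\<close> and differs from \<open>\<tau>\<close>, then \<open>\<tau> < \<sigma> = L\<close>. Call an arrival
    \<open>K\<close> skipped if \<open>\<tau> \<le> K < \<sigma>\<close>. From \<open>r\<close> on \<open>m \<le> 1\<close>, so at each skipped arrival exactly one
    further arrival is at most as likely as none; summing over all skipped arrivals, the next-to-last
    arrival is skipped at most as often as the last one (\<open>prob_skipped_le\<close>). If the next-to-last
    arrival is skipped and the last is not, \<open>\<sigma>\<close> may win at \<open>L\<close>; if the last is skipped and the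
    next-to-last is not, then \<open>\<tau> = L\<close> and \<open>\<tau>\<close> wins. So what \<open>\<sigma>\<close> gains by skipping is
    outweighed by what it loses.

  Conditioning is on deterministic times throughout: the sum over skipped arrivals is taken
  over the cells of a grid on \<open>[0, 1]\<close>, each of which ends at a deterministic time, and the mesh then
  tends to 0.
\<close>

section \<open>Unit-jump paths\<close>

locale counting_path =
  fixes c :: "real \<Rightarrow> nat"
  assumes zero: "c 0 = 0"
    and mono: "mono_on {0..1} c"
    and right_cont: "\<And>t. t \<in> {0..<1} \<Longrightarrow> continuous (at_right t) (\<lambda>u. real (c u))"
    and left_lim: "\<And>t. t \<in> {0<..1} \<Longrightarrow>
      \<exists>l. ((\<lambda>u. real (c u)) \<longlongrightarrow> l) (at_left t) \<and> real (c t) - l \<in> {0, 1}"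

text \<open>
  For unit-jump paths started at 0 this says that the path is discontinuous at \<open>t\<close>
  (\<open>discontinuous_iff_jump\<close>). The form in terms of levels is the one that can be combined with
  measurability at countably many times.
\<close>

definition jump :: "(real \<Rightarrow> nat) \<Rightarrow> real \<Rightarrow> bool" where
  "jump c t \<longleftrightarrow> t \<in> {0<..1} \<and> (\<forall>u\<in>{0..<t}. c u < c t)"

context counting_path
begin

lemma le: "0 \<le> u \<Longrightarrow> u \<le> v \<Longrightarrow> v \<le> 1 \<Longrightarrow> c u \<le> c v"
  using mono by (auto simp: mono_on_def)

lemma right_constant:
  assumes "0 \<le> t" "t < 1"
  obtains d where "0 < d" "t + d \<le> 1" "\<And>u. t \<le> u \<Longrightarrow> u < t + d \<Longrightarrow> c u = c t"
proof -
  have "((\<lambda>u. real (c u)) \<longlongrightarrow> real (c t)) (at_right t)"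
    using right_cont[of t] assms by (simp add: continuous_within)
  then have "eventually (\<lambda>u. dist (real (c u)) (real (c t)) < 1) (at_right t)"
    by (rule tendstoD) simp
  then obtain b where b: "b > t" "\<And>u. t < u \<Longrightarrow> u < b \<Longrightarrow> dist (real (c u)) (real (c t)) < 1"
    unfolding eventually_at_right_field by blast
  have "c u = c t" if "t \<le> u" "u < t + min (b - t) (1 - t)" for u
  proof (cases "u = t")
    case False
    then have "\<bar>real (c u) - real (c t)\<bar> < 1"
      using b(2)[of u] that by (auto simp: dist_real_def)
    then show ?thesis by linarith
  qed simp
  moreover have "0 < min (b - t) (1 - t)" "t + min (b - t) (1 - t) \<le> 1"
    using assms b(1) by auto
  ultimately show ?thesis using that by blast
qed

lemma left_constant:
  assumes "0 < t" "t \<le> 1"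
  obtains d l where "0 < d" "d \<le> t" "c t = l \<or> c t = l + 1"
    "\<And>u. t - d < u \<Longrightarrow> u < t \<Longrightarrow> c u = l"
proof -
  obtain r where r: "((\<lambda>u. real (c u)) \<longlongrightarrow> r) (at_left t)" "real (c t) - r \<in> {0, 1}"
    using left_lim[of t] assms by auto
  have "eventually (\<lambda>u. dist (real (c u)) r < 1) (at_left t)"
    using r(1) by (rule tendstoD) simp
  then obtain b where b: "b < t" "\<And>u. b < u \<Longrightarrow> u < t \<Longrightarrow> dist (real (c u)) r < 1"
    unfolding eventually_at_left_field by blast
  let ?d = "min (t - b) t"
  have near: "\<bar>real (c u) - r\<bar> < 1" if "t - ?d < u" "u < t" for u
    using b(2)[of u] that by (auto simp: dist_real_def)
  have d: "0 < ?d" "?d \<le> t" using assms b(1) by auto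
  have "\<exists>l. r = real l"
  proof (cases "real (c t) - r = 0")
    case False
    then have "r = real (c t) - 1" using r(2) by simp
    moreover have "\<bar>real (c (t - ?d / 2)) - r\<bar> < 1"
      using d by (intro near) auto
    ultimately have "c t \<noteq> 0" by (cases "c t = 0") auto
    then show ?thesis using \<open>r = real (c t) - 1\<close> by (intro exI[of _ "c t - 1"]) (auto simp: of_nat_diff)
  qed auto
  then obtain l where l: "r = real l" by blast
  have "c t = l \<or> c t = l + 1" using r(2) l by auto
  moreover have "c u = l" if "t - ?d < u" "u < t" for u
    using near[OF that] l by linarith
  ultimately show ?thesis using that d by blast
qed

lemma discontinuous_iff_jump:
  "t \<in> {0..1} \<and> \<not> continuous (at t within {0..1}) (\<lambda>u. real (c u)) \<longleftrightarrow> jump c t"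
proof (intro iffI; (elim conjE)?)
  assume t: "t \<in> {0..1}" and dis: "\<not> continuous (at t within {0..1}) (\<lambda>u. real (c u))"
  have locally_constant: False
    if d: "0 < d" "\<And>u. u \<in> {0..1} \<Longrightarrow> \<bar>u - t\<bar> < d \<Longrightarrow> c u = c t" for d
  proof -
    have "continuous (at t within {0..1}) (\<lambda>u. real (c u))"
      unfolding continuous_within_eps_delta
      using d by (auto simp: dist_real_def intro!: exI[of _ d])
    then show False using dis by blast
  qed
  have right: "\<exists>d>0. \<forall>u\<in>{0..1}. t \<le> u \<and> u < t + d \<longrightarrow> c u = c t"
  proof (cases "t = 1")
    case True then show ?thesis by (auto intro!: exI[of _ 1])
  next
    case False
    then obtain d where "0 < d" "\<And>u. t \<le> u \<Longrightarrow> u < t + d \<Longrightarrow> c u = c t"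
      using right_constant[of t] t by auto
    then show ?thesis by blast
  qed
  then obtain d where d: "0 < d" "\<forall>u\<in>{0..1}. t \<le> u \<and> u < t + d \<longrightarrow> c u = c t"
    by blast
  have "0 < t"
  proof (rule ccontr)
    assume "\<not> 0 < t"
    then have "t = 0" using t by simp
    show False
    proof (rule locally_constant[OF d(1)])
      fix u assume "u \<in> {0..1}" "\<bar>u - t\<bar> < d"
      then have "t \<le> u \<and> u < t + d" using \<open>t = 0\<close> by auto
      then show "c u = c t" using d(2) \<open>u \<in> {0..1}\<close> by blast
    qed
  qed
  moreover have "c u < c t" if u: "u \<in> {0..<t}" for u
  proof (rule ccontr)
    assume "\<not> c u < c t"
    then have eq: "c v = c t" if "u \<le> v" "v \<le> t" for v
      using le[of u v] le[of v t] that u t by force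
    show False
    proof (rule locally_constant[of "min d (t - u)"])
      fix v assume "v \<in> {0..1}" "\<bar>v - t\<bar> < min d (t - u)"
      then have "v \<le> t \<Longrightarrow> u \<le> v" "v < t + d" "v \<in> {0..1}" by auto
      then show "c v = c t" using d(2)[rule_format, of v] eq[of v] by (meson nle_le)
    next
      show "0 < min d (t - u)" using d(1) u by simp
    qed
  qed
  ultimately show "jump c t" using t by (auto simp: jump_def)
next
  assume j: "jump c t"
  then have t: "0 < t" "t \<le> 1" by (auto simp: jump_def)
  have False if "continuous (at t within {0..1}) (\<lambda>u. real (c u))"
  proof -
    have "\<exists>d>0. \<forall>u\<in>{0..1}. dist u t < d \<longrightarrow> dist (real (c u)) (real (c t)) < 1"
      using that unfolding continuous_within_eps_delta by (elim allE[of _ 1]) simp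
    then obtain d where
      d: "0 < d" "\<And>u. u \<in> {0..1} \<Longrightarrow> dist u t < d \<Longrightarrow> dist (real (c u)) (real (c t)) < 1"
      by blast
    define u where "u = max 0 (t - d / 2)"
    have u: "0 \<le> u" "u < t" "dist u t < d" using t d(1) by (auto simp: u_def dist_real_def)
    then have "c u < c t" using j by (auto simp: jump_def)
    moreover have "dist (real (c u)) (real (c t)) < 1" using u t by (intro d(2)) auto
    ultimately show False by (auto simp: dist_real_def)
  qed
  then show "t \<in> {0..1} \<and> \<not> continuous (at t within {0..1}) (\<lambda>u. real (c u))" using t by auto
qed

text \<open>
  The first time at which the level \<open>j\<close> is reached or exceeded is a jump by right continuity, and it
  hits \<open>j\<close> exactly because the path is below \<open>j\<close> on its left and jumps by at most one.
\<close>

lemma level_reached_by_jump: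
  assumes "0 \<le> u" "u \<le> v" "v \<le> 1" "c u < j" "j \<le> c v"
  obtains t where "u < t" "t \<le> v" "jump c t" "c t = j"
proof -
  have uv: "u < v"
    using assms by (cases "u = v") auto
  define S where "S = {t \<in> {u..v}. j \<le> c t}"
  define t where "t = Inf S"
  have "v \<in> S" using assms uv by (auto simp: S_def)
  have bdd: "bdd_below S" by (auto simp: S_def bdd_below_def)
  have "u \<le> t" unfolding t_def by (rule cInf_greatest) (use \<open>v \<in> S\<close> in \<open>auto simp: S_def\<close>)
  have "t \<le> v" unfolding t_def by (rule cInf_lower[OF \<open>v \<in> S\<close> bdd])
  have below: "c s < j" if "0 \<le> s" "s < t" for s
  proof (cases "u \<le> s")
    case True
    then show ?thesis using that cInf_lower[OF _ bdd, of s] \<open>t \<le> v\<close>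
      by (fastforce simp: S_def t_def)
  next
    case False
    then show ?thesis using le[of s u] that assms \<open>u \<le> t\<close> \<open>t \<le> v\<close> by simp
  qed
  have tj: "j \<le> c t"
  proof (cases "t = 1")
    case True
    then show ?thesis using \<open>t \<le> v\<close> assms by simp
  next
    case False
    then obtain d where d: "0 < d" "\<And>x. t \<le> x \<Longrightarrow> x < t + d \<Longrightarrow> c x = c t"
      using right_constant[of t] assms \<open>u \<le> t\<close> \<open>t \<le> v\<close> by auto
    obtain x where "x \<in> S" "x < t + d"
      using cInf_lessD[of S "t + d"] \<open>v \<in> S\<close> d(1) by (auto simp: t_def)
    moreover have "t \<le> x" unfolding t_def by (rule cInf_lower[OF \<open>x \<in> S\<close> bdd])
    ultimately show ?thesis using d(2)[of x] by (auto simp: S_def)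
  qed
  then have "u < t" using assms \<open>u \<le> t\<close> by (cases "u = t") auto
  then have t01: "0 < t" "t \<le> 1" using assms \<open>t \<le> v\<close> by auto
  obtain d l where l: "0 < d" "d \<le> t" "c t = l \<or> c t = l + 1"
    "\<And>x. t - d < x \<Longrightarrow> x < t \<Longrightarrow> c x = l"
    using left_constant[OF t01] by blast
  have "l < j" using l(1,2) l(4)[of "t - d / 2"] below[of "t - d / 2"] by simp
  then have "c t = j" using l(3) tj by auto
  moreover have "jump c t"
    using below tj t01 unfolding jump_def by (metis atLeastLessThan_iff greaterThanAtMost_iff less_le_trans)
  ultimately show ?thesis using that \<open>u < t\<close> \<open>t \<le> v\<close> by blast
qed

lemma jump_less: "jump c t \<Longrightarrow> 0 \<le> u \<Longrightarrow> u < t \<Longrightarrow> c u < c t"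
  by (auto simp: jump_def)

lemma jump_le_iff:
  assumes "jump c t" "0 \<le> u" "u \<le> 1"
  shows "t \<le> u \<longleftrightarrow> c t \<le> c u"
proof
  show "t \<le> u \<Longrightarrow> c t \<le> c u" using assms le[of t u] by (auto simp: jump_def)
  show "c t \<le> c u \<Longrightarrow> t \<le> u" using assms jump_less[of t u] by (cases "t \<le> u") auto
qed

text \<open>
  The path increases strictly along its jumps, so a jump of minimal level is a jump of minimal time.
\<close>

lemma first_jump_exists:
  assumes "jump c t" "P t"
  obtains r where "jump c r" "P r" "\<And>t. jump c t \<Longrightarrow> P t \<Longrightarrow> r \<le> t"
proof -
  obtain r where r: "jump c r \<and> P r" "\<And>t. jump c t \<and> P t \<Longrightarrow> c r \<le> c t"
    using ex_has_least_nat[of "\<lambda>t. jump c t \<and> P t" t c] assms by blast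
  have "r \<le> t" if "jump c t" "P t" for t
    using r(1) r(2)[of t] that by (subst jump_le_iff) (auto simp: jump_def)
  then show ?thesis using that r by blast
qed

lemma last_jump_iff:
  assumes "jump c t"
  shows "(\<forall>u. jump c u \<longrightarrow> u \<le> t) \<longleftrightarrow> c t = c 1"
proof
  assume last: "\<forall>u. jump c u \<longrightarrow> u \<le> t"
  show "c t = c 1"
  proof (rule ccontr)
    assume "c t \<noteq> c 1"
    then have "c t < c 1" using le[of t 1] assms by (auto simp: jump_def)
    then obtain u where "t < u" "jump c u"
      by (rule level_reached_by_jump[of t 1 "c 1", rotated 3]) (use assms in \<open>auto simp: jump_def\<close>)
    then show False using last by auto
  qed
next
  assume eq: "c t = c 1"
  show "\<forall>u. jump c u \<longrightarrow> u \<le> t"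
  proof (intro allI impI)
    fix u assume u: "jump c u"
    then have "c u \<le> c t" using eq le[of u 1] by (auto simp: jump_def)
    then show "u \<le> t" using u assms by (subst jump_le_iff) (auto simp: jump_def)
  qed
qed

lemma last_jump_exists:
  assumes "0 < c 1"
  obtains L where "jump c L" "c L = c 1"
  using level_reached_by_jump[of 0 1 "c 1"] zero assms by auto

lemma jump_eq_iff:
  assumes "jump c s" "jump c t"
  shows "s = t \<longleftrightarrow> c s = c t"
  using jump_le_iff[OF assms(1), of t] jump_le_iff[OF assms(2), of s] assms
  by (auto simp: jump_def intro: order_antisym)

text \<open>
  Around each time the path takes at most two values, which differ by one; compactness of the unit
  interval makes the radius uniform.
\<close>

lemma at_most_one_jump_in_short_intervals:
  obtains d where "0 < d" "\<And>x y. 0 \<le> x \<Longrightarrow> x \<le> y \<Longrightarrow> y \<le> 1 \<Longrightarrow> y < x + d \<Longrightarrow> c y \<le> c x + 1"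
proof -
  define good where
    "good t d \<longleftrightarrow> (\<forall>x y. 0 \<le> x \<and> x \<le> y \<and> y \<le> 1 \<and> \<bar>x - t\<bar> < d \<and> \<bar>y - t\<bar> < d \<longrightarrow> c y \<le> c x + 1)"
    for t d
  have "\<exists>d>0. good t d" if t: "t \<in> {0..1}" for t
  proof -
    obtain a where a: "0 < a" "\<And>x. t \<le> x \<Longrightarrow> x < t + a \<Longrightarrow> x \<le> 1 \<Longrightarrow> c x = c t"
    proof (cases "t = 1")
      case True then show ?thesis by (intro that[of 1]) auto
    next
      case False
      then show ?thesis using right_constant[of t] t that by (metis atLeastAtMost_iff less_eq_real_def)
    qed
    obtain b l where b: "0 < b" "c t = l \<or> c t = l + 1"
      "\<And>x. 0 \<le> x \<Longrightarrow> t - b < x \<Longrightarrow> x < t \<Longrightarrow> c x = l"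
    proof (cases "t = 0")
      case True then show ?thesis by (intro that[of 1 "c t"]) auto
    next
      case False
      then show ?thesis using left_constant[of t] t that by (metis atLeastAtMost_iff less_eq_real_def)
    qed
    have "c y \<le> c x + 1"
      if "0 \<le> x" "x \<le> y" "y \<le> 1" "\<bar>x - t\<bar> < min a b" "\<bar>y - t\<bar> < min a b" for x y
      using a(2)[of x] a(2)[of y] b(2) b(3)[of x] b(3)[of y] that
      by (cases "x < t"; cases "y < t") auto
    then have "good t (min a b)" by (auto simp: good_def)
    then show ?thesis using a(1) b(1) by (intro exI[of _ "min a b"]) auto
  qed
  then obtain d where d: "\<And>t. t \<in> {0..1} \<Longrightarrow> 0 < d t" "\<And>t. t \<in> {0..1} \<Longrightarrow> good t (d t)"
    by metis
  obtain e where e: "0 < e" "\<And>x. x \<in> {0..1} \<Longrightarrow> \<exists>G \<in> (\<lambda>t. ball t (d t)) ` {0..1}. ball x e \<subseteq> G"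
  proof (rule Heine_Borel_lemma[of "{0..1::real}" "(\<lambda>t. ball t (d t)) ` {0..1}"])
    show "{0..1} \<subseteq> \<Union> ((\<lambda>t. ball t (d t)) ` {0..1})" using d(1) by force
  qed auto
  show ?thesis
  proof (rule that[OF e(1)])
    fix x y :: real assume xy: "0 \<le> x" "x \<le> y" "y \<le> 1" "y < x + e"
    then obtain t where t: "t \<in> {0..1}" "ball x e \<subseteq> ball t (d t)"
      using e(2)[of x] by auto
    moreover have "x \<in> ball x e" "y \<in> ball x e" using xy e(1) by (auto simp: dist_real_def)
    ultimately have "x \<in> ball t (d t)" "y \<in> ball t (d t)" by blast+
    then show "c y \<le> c x + 1" using d(2)[OF t(1)] xy unfolding good_def
      by (auto simp: dist_real_def abs_minus_commute)
  qed
qed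

end

section \<open>Uniform grids and occupied cells\<close>

definition grid :: "real \<Rightarrow> nat \<Rightarrow> nat \<Rightarrow> real" where
  "grid s n k = s + (1 - s) * real k / real n"

lemma grid_0 [simp]: "grid s n 0 = s"
  by (simp add: grid_def)

lemma grid_top [simp]: "0 < n \<Longrightarrow> grid s n n = 1"
  by (simp add: grid_def)

lemma grid_mono: "s \<le> 1 \<Longrightarrow> k \<le> l \<Longrightarrow> grid s n k \<le> grid s n l"
  by (auto simp: grid_def intro!: divide_right_mono mult_left_mono)

lemma grid_bounds:
  assumes "s \<le> 1" "0 < n" "k \<le> n"
  shows "s \<le> grid s n k" "grid s n k \<le> 1"
  using grid_mono[OF assms(1), of 0 k n] grid_mono[OF assms(1,3), of n] assms(2) by auto

lemma grid_step: "0 < n \<Longrightarrow> grid s n (Suc k) = grid s n k + (1 - s) / real n"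
  by (simp add: grid_def field_simps)

definition occupied_cells :: "(real \<Rightarrow> nat) \<Rightarrow> real \<Rightarrow> nat \<Rightarrow> nat set" where
  "occupied_cells c s n = {k \<in> {..<n}. c (grid s n (Suc k)) \<noteq> c (grid s n k)}"

lemma card_occupied_cells:
  "card (occupied_cells c s n) = (\<Sum>k<n. if c (grid s n (Suc k)) \<noteq> c (grid s n k) then 1 else 0)"
  by (simp add: occupied_cells_def sum.If_cases Int_def conj_commute)

context counting_path
begin

lemma grid_le:
  assumes "0 \<le> s" "s \<le> 1" "k \<le> l" "l \<le> n" "0 < n"
  shows "c (grid s n k) \<le> c (grid s n l)"
  using assms grid_bounds[of s n k] grid_bounds[of s n l] by (intro le grid_mono) auto

lemma increment_eq_sum:
  assumes "0 \<le> s" "s \<le> 1" "0 < n"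
  shows "c 1 - c s = (\<Sum>k<n. c (grid s n (Suc k)) - c (grid s n k))"
proof -
  have "c (grid s n j) - c s = (\<Sum>k<j. c (grid s n (Suc k)) - c (grid s n k))" if "j \<le> n" for j
    using that
  proof (induction j)
    case (Suc j)
    then show ?case using assms grid_le[of s 0 j n] grid_le[of s j "Suc j" n] by simp
  qed simp
  from this[of n] show ?thesis using assms by simp
qed

lemma card_occupied_cells_le:
  assumes "0 \<le> s" "s \<le> 1" "0 < n"
  shows "card (occupied_cells c s n) \<le> c 1 - c s"
  unfolding card_occupied_cells increment_eq_sum[OF assms]
proof (rule sum_mono)
  fix k assume "k \<in> {..<n}"
  then show "(if c (grid s n (Suc k)) \<noteq> c (grid s n k) then 1 else 0)
      \<le> c (grid s n (Suc k)) - c (grid s n k)"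
    using grid_le[of s k "Suc k" n] assms by auto
qed

lemma eventually_card_occupied_cells:
  assumes "0 \<le> s" "s \<le> 1"
  shows "eventually (\<lambda>n. card (occupied_cells c s n) = c 1 - c s) sequentially"
proof -
  obtain d where d: "0 < d"
    "\<And>x y. 0 \<le> x \<Longrightarrow> x \<le> y \<Longrightarrow> y \<le> 1 \<Longrightarrow> y < x + d \<Longrightarrow> c y \<le> c x + 1"
    using at_most_one_jump_in_short_intervals by blast
  have "eventually (\<lambda>n. (1 - s) / real n < d) sequentially"
    using order_tendstoD(2)[OF lim_const_over_n d(1)] .
  moreover have "eventually (\<lambda>n::nat. 0 < n) sequentially" by (rule eventually_gt_at_top)
  ultimately show ?thesis
  proof eventually_elim
    case (elim n)
    show ?case unfolding card_occupied_cells increment_eq_sum[OF assms elim(2)]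
    proof (rule sum.cong[OF refl])
      fix k assume "k \<in> {..<n}"
      then have kn: "k < n" by simp
      have "c (grid s n k) \<le> c (grid s n (Suc k))"
        using kn grid_le[of s k "Suc k" n] assms elim by simp
      moreover have "c (grid s n (Suc k)) \<le> c (grid s n k) + 1"
      proof (rule d(2))
        show "0 \<le> grid s n k" using grid_bounds(1)[of s n k] kn assms by simp
        show "grid s n k \<le> grid s n (Suc k)" using assms by (intro grid_mono) auto
        show "grid s n (Suc k) \<le> 1" using grid_bounds(2)[of s n "Suc k"] kn assms by simp
        show "grid s n (Suc k) < grid s n k + d" using elim grid_step[of n s k] by simp
      qed
      ultimately
      show "(if c (grid s n (Suc k)) \<noteq> c (grid s n k) then 1 else 0)
          = c (grid s n (Suc k)) - c (grid s n k)" by auto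
    qed
  qed
qed

text \<open>
  The right-hand side splits the event into past, cell \<open>k\<close>, and future, which is what two
  applications of independent increments can handle.
\<close>

lemma occupied_cells_eq_singleton_iff:
  assumes "0 \<le> s" "s \<le> 1" "k < n"
  shows "occupied_cells c s n = {k} \<longleftrightarrow>
    c (grid s n k) = c s \<and> c (grid s n (Suc k)) \<noteq> c (grid s n k) \<and> c 1 = c (grid s n (Suc k))"
proof
  assume one: "occupied_cells c s n = {k}"
  then have "c (grid s n (Suc k)) \<noteq> c (grid s n k)" by (auto simp: occupied_cells_def)
  moreover have same: "c (grid s n (Suc i)) = c (grid s n i)" if "i < n" "i \<noteq> k" for i
    using one that unfolding occupied_cells_def by (force simp: set_eq_iff)
  moreover have "c (grid s n i) = c s" if "i \<le> k" for i
    using that assms(3) by (induction i) (auto simp: same)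
  moreover have "i \<le> n \<Longrightarrow> c (grid s n i) = c (grid s n (Suc k))" if "Suc k \<le> i" for i
    using that by (induction i rule: dec_induct) (auto simp: same)
  from this[of n] have "c 1 = c (grid s n (Suc k))" using assms by simp
  ultimately show "c (grid s n k) = c s \<and> c (grid s n (Suc k)) \<noteq> c (grid s n k)
      \<and> c 1 = c (grid s n (Suc k))" by auto
next
  assume A: "c (grid s n k) = c s \<and> c (grid s n (Suc k)) \<noteq> c (grid s n k)
      \<and> c 1 = c (grid s n (Suc k))"
  have "c (grid s n (Suc i)) = c (grid s n i)" if "i < n" "i \<noteq> k" for i
  proof (cases "i < k")
    case True
    then show ?thesis
      using A assms that grid_le[of s 0 i n] grid_le[of s i "Suc i" n] grid_le[of s "Suc i" k n] by simp
  next
    case False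
    then show ?thesis
      using A assms that grid_le[of s "Suc k" i n] grid_le[of s i "Suc i" n] grid_le[of s "Suc i" n n]
      by simp
  qed
  moreover have "k \<in> occupied_cells c s n" using A assms(3) by (simp add: occupied_cells_def)
  ultimately show "occupied_cells c s n = {k}" unfolding occupied_cells_def by blast
qed

end

section \<open>The process and its increments\<close>

lemma Riemann_integrable_imp_integrable:
  assumes "Riemann_integrable_on f a b"
  shows "f integrable_on {a..b}"
proof -
  obtain I where I: "\<And>e. e > 0 \<Longrightarrow> \<exists>d>0. \<forall>p. p tagged_division_of {a..b} \<and> (\<lambda>x. ball x d) fine p \<longrightarrow>
        \<bar>(\<Sum>(x, K)\<in>p. measure lborel K * f x) - I\<bar> < e"
    using assms unfolding Riemann_integrable_on_def by blast
  have "(f has_integral I) {a..b}"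
    unfolding has_integral_real
  proof (intro allI impI)
    fix e :: real assume "e > 0"
    then obtain d where "d > 0" "\<forall>p. p tagged_division_of {a..b} \<and> (\<lambda>x. ball x d) fine p \<longrightarrow>
        \<bar>(\<Sum>(x, K)\<in>p. measure lborel K * f x) - I\<bar> < e"
      using I by blast
    then show "\<exists>\<gamma>. gauge \<gamma> \<and> (\<forall>\<D>. \<D> tagged_division_of {a..b} \<and> \<gamma> fine \<D> \<longrightarrow>
        norm ((\<Sum>(x, k)\<in>\<D>. measure lborel k *\<^sub>R f x) - I) < e)"
      by (intro exI[of _ "\<lambda>x. ball x d"] conjI gauge_ball) auto
  qed
  then show ?thesis by blast
qed

locale last_arrival_problem = prob_space M + filtration "space M" F
  for M :: "'a measure" and F :: "real \<Rightarrow> 'a measure" +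
  fixes C :: "real \<Rightarrow> 'a \<Rightarrow> nat" and T :: "'a \<Rightarrow> real" and \<eta> :: "real \<Rightarrow> real"
  assumes sets_F: "\<And>t. sets (F t) \<subseteq> sets M"
    and counting: "counting_process F (space M) C"
    and stopping_T: "stopping_time F T"
    and T_range: "\<And>\<omega>. \<omega> \<in> space M \<Longrightarrow> T \<omega> \<in> {0..1}"
    and independent: "confined_independent_increments M F C T"
    and intensity: "confined_intensity M C T \<eta>"
    and Riemann: "Riemann_integrable_on \<eta> 0 1"
    and integrable_C: "integrable M (\<lambda>\<omega>. real (C 1 \<omega>))"
begin

abbreviation started :: "real \<Rightarrow> 'a set" where
  "started s \<equiv> {\<omega> \<in> space M. T \<omega> \<le> s}"

abbreviation mean_after :: "real \<Rightarrow> real" where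
  "mean_after s \<equiv> integral {s..1} \<eta>"

lemma path: "\<omega> \<in> space M \<Longrightarrow> counting_path (\<lambda>t. C t \<omega>)"
  using counting unfolding counting_process_def counting_path_def by blast

lemma arrival_iff_jump:
  "\<omega> \<in> space M \<Longrightarrow> arrival_time C \<omega> t \<longleftrightarrow> jump (\<lambda>t. C t \<omega>) t"
  unfolding arrival_time_def by (rule counting_path.discontinuous_iff_jump[OF path])

lemma F_subalgebra: "s \<le> t \<Longrightarrow> A \<in> sets (F s) \<Longrightarrow> A \<in> sets (F t)"
  using sets_F_mono by blast

lemma C_measurable_F:
  assumes "0 \<le> t" "t \<le> 1" "t \<le> u"
  shows "C t \<in> F u \<rightarrow>\<^sub>M count_space UNIV"
proof (rule measurableI)
  fix A assume A: "A \<in> sets (count_space (UNIV :: nat set))"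
  have "t \<in> {0..1}" using assms by simp
  then have "C t \<in> F t \<rightarrow>\<^sub>M count_space UNIV"
    using counting unfolding counting_process_def by blast
  then have "C t -` A \<inter> space (F t) \<in> sets (F t)"
    using A by (rule measurable_sets)
  then show "C t -` A \<inter> space (F u) \<in> sets (F u)"
    unfolding space_F by (rule F_subalgebra[OF assms(3)])
qed simp

lemma F_to_M: "f \<in> F t \<rightarrow>\<^sub>M N \<Longrightarrow> f \<in> M \<rightarrow>\<^sub>M N"
  using sets_F[of t] by (auto simp: measurable_def space_F)

lemma C_measurable [measurable]: "0 \<le> t \<Longrightarrow> t \<le> 1 \<Longrightarrow> C t \<in> M \<rightarrow>\<^sub>M count_space UNIV"
  using F_to_M[OF C_measurable_F[of t t]] by simp

lemma C_event_F:
  assumes A: "A \<in> sets (F u)" and s: "0 \<le> s" "s \<le> 1" "s \<le> u" and t: "0 \<le> t" "t \<le> 1" "t \<le> u"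
  shows "{\<omega> \<in> A. P (C s \<omega>) (C t \<omega>)} \<in> sets (F u)"
proof -
  note [measurable] = C_measurable_F[OF s] C_measurable_F[OF t]
  have "{\<omega> \<in> space (F u). \<exists>i j. C s \<omega> = i \<and> C t \<omega> = j \<and> P i j} \<in> sets (F u)"
    by measurable
  then have "A \<inter> {\<omega> \<in> space (F u). \<exists>i j. C s \<omega> = i \<and> C t \<omega> = j \<and> P i j} \<in> sets (F u)"
    by (rule sets.Int[OF A])
  moreover have "A \<inter> {\<omega> \<in> space (F u). \<exists>i j. C s \<omega> = i \<and> C t \<omega> = j \<and> P i j}
      = {\<omega> \<in> A. P (C s \<omega>) (C t \<omega>)}"
    using sets.sets_into_space[OF A] by auto
  ultimately show ?thesis by simp
qed

lemma C_event:
  assumes A: "A \<in> sets M" and s: "0 \<le> s" "s \<le> 1" and t: "0 \<le> t" "t \<le> 1"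
  shows "{\<omega> \<in> A. P (C s \<omega>) (C t \<omega>)} \<in> sets M"
proof -
  have "{\<omega> \<in> space M. P (C s \<omega>) (C t \<omega>)} \<in> sets (F 1)"
    using C_event_F[of "space M" 1 s t P] s t sets.top[of "F 1"] by (simp add: space_F)
  then have "A \<inter> {\<omega> \<in> space M. P (C s \<omega>) (C t \<omega>)} \<in> sets M"
    using A sets_F by blast
  moreover have "A \<inter> {\<omega> \<in> space M. P (C s \<omega>) (C t \<omega>)} = {\<omega> \<in> A. P (C s \<omega>) (C t \<omega>)}"
    using sets.sets_into_space[OF A] by auto
  ultimately show ?thesis by simp
qed

lemma stopped_by:
  assumes "stopping_time F \<sigma>" "s \<le> t"
  shows "{\<omega> \<in> space M. \<sigma> \<omega> \<le> s} \<in> sets (F t)"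
  using stopping_time_le_const[OF assms] by (simp add: pred_def space_F)

lemma started_F: "s \<le> t \<Longrightarrow> started s \<in> sets (F t)"
  by (rule stopped_by[OF stopping_T])

lemma started_M [measurable]: "started s \<in> sets M"
  using started_F[of s s] sets_F by auto

text \<open>
  The conditional law of the increment over \<open>(u, t]\<close> given that the confined process has started by
  time \<open>u\<close>. Where the condition has probability 0 the quotient is 0.
\<close>

definition increment_law :: "real \<Rightarrow> real \<Rightarrow> nat set \<Rightarrow> real" where
  "increment_law u t B =
     prob {\<omega> \<in> space M. T \<omega> \<le> u \<and> C t \<omega> - C u \<omega> \<in> B} / prob (started u)"

text \<open>
  The increment is independent of \<open>F u\<close> under the probability conditioned on \<open>started u\<close>; events inside
  \<open>started u\<close> do not see the conditioning, so that the same factor \<open>increment_law u t B\<close> serves for all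
  of them. If \<open>started u\<close> is null, both sides vanish.
\<close>

lemma increment_law:
  assumes A: "A \<in> sets (F u)" "A \<subseteq> started u" and u: "0 \<le> u" "u \<le> t" "t \<le> 1"
  shows "prob {\<omega> \<in> A. C t \<omega> - C u \<omega> \<in> B} = prob A * increment_law u t B"
proof (cases "prob (started u) = 0")
  case True
  have "prob A \<le> prob (started u)" "prob {\<omega> \<in> A. C t \<omega> - C u \<omega> \<in> B} \<le> prob (started u)"
    using A(2) by (auto intro!: finite_measure_mono)
  then show ?thesis using True by (simp add: measure_le_0_iff)
next
  case False
  then have pos: "prob (started u) > 0" by (simp add: zero_less_measure_iff)
  let ?Q = "given_started M T u"
  have em: "emeasure M (started u) \<noteq> 0" "emeasure M (started u) \<noteq> \<infinity>"
    using False by (auto simp: emeasure_eq_measure)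
  interpret Q: prob_space ?Q
    unfolding given_started_def by (rule prob_space_uniform_measure[OF em])
  have Q: "Q.prob E = prob (started u \<inter> E) / prob (started u)" if "E \<in> sets M" for E
    unfolding given_started_def by (rule measure_uniform_measure[OF em that])
  let ?E = "(\<lambda>\<omega>. C t \<omega> - C u \<omega>) -` B \<inter> space M"
  have [measurable]: "C t \<in> M \<rightarrow>\<^sub>M count_space UNIV" "C u \<in> M \<rightarrow>\<^sub>M count_space UNIV"
    using u by auto
  have E: "?E \<in> sets M" by measurable
  have AM: "A \<in> sets M" using A sets_F by blast
  have "Q.indep_set (sets (F u)) {(\<lambda>\<omega>. C t \<omega> - C u \<omega>) -` B \<inter> space M | B. True}"
    using independent u pos unfolding confined_independent_increments_def by blast
  then have "Q.prob (A \<inter> ?E) = Q.prob A * Q.prob ?E"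
    by (rule Q.indep_setD) (use A in auto)
  moreover have "started u \<inter> (A \<inter> ?E) = {\<omega> \<in> A. C t \<omega> - C u \<omega> \<in> B}" "started u \<inter> A = A"
    "started u \<inter> ?E = {\<omega> \<in> space M. T \<omega> \<le> u \<and> C t \<omega> - C u \<omega> \<in> B}"
    using A by auto
  ultimately show ?thesis
    using pos AM E by (simp add: Q increment_law_def nonzero_eq_divide_eq nonzero_divide_eq_eq)
qed

lemma integral_given_started:
  fixes f :: "'a \<Rightarrow> real"
  assumes "f \<in> borel_measurable M" "prob (started s) > 0"
  shows "(\<integral>\<omega>. f \<omega> \<partial>given_started M T s) = (\<integral>\<omega>. indicator (started s) \<omega> * f \<omega> \<partial>M) / prob (started s)"
proof -
  have "given_started M T s
      = density M (\<lambda>\<omega>. ennreal (indicator (started s) \<omega> / prob (started s)))"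
    unfolding given_started_def uniform_measure_def using assms(2)
    by (intro arg_cong[where f = "density M"] ext)
      (auto simp: emeasure_eq_measure divide_ennreal simp flip: ennreal_1 split: split_indicator)
  then have "(\<integral>\<omega>. f \<omega> \<partial>given_started M T s)
      = (\<integral>\<omega>. (indicator (started s) \<omega> / prob (started s)) *\<^sub>R f \<omega> \<partial>M)"
    using assms by (simp add: integral_density)
  also have "\<dots> = (\<integral>\<omega>. (indicator (started s) \<omega> * f \<omega>) / prob (started s) \<partial>M)"
    by (intro Bochner_Integration.integral_cong) auto
  finally show ?thesis by simp
qed

lemma increment_le_C1: "\<omega> \<in> space M \<Longrightarrow> 0 \<le> t \<Longrightarrow> t \<le> 1 \<Longrightarrow> C t \<omega> - C s \<omega> \<le> C 1 \<omega>"
  using counting_path.le[OF path, of \<omega> t 1] by simp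

lemma expected_increment:
  assumes "0 \<le> s" "s \<le> t" "t \<le> 1"
  shows "(\<integral>\<omega>. indicator (started s) \<omega> * real (C t \<omega> - C s \<omega>) \<partial>M)
    = prob (started s) * integral {s..t} \<eta>"
proof (cases "prob (started s) = 0")
  case True
  then have "AE \<omega> in M. \<omega> \<notin> started s"
    by (simp add: prob_eq_0 AE_iff_measurable)
  then have "(\<integral>\<omega>. indicator (started s) \<omega> * real (C t \<omega> - C s \<omega>) \<partial>M) = 0"
    by (intro integral_eq_zero_AE) (auto elim!: eventually_mono)
  then show ?thesis using True by simp
next
  case False
  then have pos: "prob (started s) > 0" by (simp add: zero_less_measure_iff)
  have [measurable]: "C t \<in> M \<rightarrow>\<^sub>M count_space UNIV" "C s \<in> M \<rightarrow>\<^sub>M count_space UNIV"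
    using assms by auto
  have "(\<lambda>\<omega>. real (C t \<omega> - C s \<omega>)) \<in> borel_measurable M" by measurable
  from integral_given_started[OF this pos] show ?thesis
    using intensity pos assms unfolding confined_intensity_def by (auto simp: field_simps)
qed

lemma increment_prob_le:
  assumes "0 \<le> s" "s \<le> t" "t \<le> 1"
  shows "prob {\<omega> \<in> started s. C t \<omega> \<noteq> C s \<omega>} \<le> prob (started s) * integral {s..t} \<eta>"
proof -
  define J where "J = {\<omega> \<in> started s. C t \<omega> \<noteq> C s \<omega>}"
  have J: "J \<in> sets M"
    unfolding J_def using assms by (intro C_event started_M) auto
  have [measurable]: "C t \<in> M \<rightarrow>\<^sub>M count_space UNIV" "C s \<in> M \<rightarrow>\<^sub>M count_space UNIV"
    using assms by auto
  have "J \<inter> space M = J" using sets.sets_into_space[OF J] by blast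
  then have "prob J = (\<integral>\<omega>. indicator J \<omega> \<partial>M)" by simp
  also have "\<dots> \<le> (\<integral>\<omega>. indicator (started s) \<omega> * real (C t \<omega> - C s \<omega>) \<partial>M)"
  proof (rule integral_mono_AE)
    show "integrable M (\<lambda>\<omega>. indicator J \<omega> :: real)"
      using J by (intro integrable_real_indicator) (simp_all add: emeasure_eq_measure)
    show "integrable M (\<lambda>\<omega>. indicator (started s) \<omega> * real (C t \<omega> - C s \<omega>))"
      using increment_le_C1[of _ t s] assms
      by (intro Bochner_Integration.integrable_bound[OF integrable_C])
        (auto split: split_indicator)
    show "AE \<omega> in M. indicator J \<omega> \<le> indicator (started s) \<omega> * real (C t \<omega> - C s \<omega>)"
    proof (rule AE_I2)
      fix \<omega> assume "\<omega> \<in> space M"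
      then show "indicator J \<omega> \<le> indicator (started s) \<omega> * real (C t \<omega> - C s \<omega>)"
        using counting_path.le[OF path, of \<omega> s t] assms by (auto simp: J_def split: split_indicator)
    qed
  qed
  finally show ?thesis using expected_increment[OF assms] by (simp add: J_def)
qed

section \<open>The expected number of remaining arrivals\<close>

lemma eta_integrable: "0 \<le> a \<Longrightarrow> b \<le> 1 \<Longrightarrow> \<eta> integrable_on {a..b}"
  by (rule integrable_on_subinterval[OF Riemann_integrable_imp_integrable[OF Riemann]]) auto

lemma integral_split:
  "0 \<le> a \<Longrightarrow> a \<le> b \<Longrightarrow> b \<le> 1 \<Longrightarrow> integral {a..b} \<eta> = mean_after a - mean_after b"
  using Henstock_Kurzweil_Integration.integral_combine[of a b 1 \<eta>] eta_integrable[of a 1] by simp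

lemma integral_nonneg_eta: "0 \<le> a \<Longrightarrow> b \<le> 1 \<Longrightarrow> 0 \<le> integral {a..b} \<eta>"
  using intensity eta_integrable[of a b]
  by (intro Henstock_Kurzweil_Integration.integral_nonneg) (auto simp: confined_intensity_def)

lemma mean_after_antimono: "0 \<le> a \<Longrightarrow> a \<le> b \<Longrightarrow> b \<le> 1 \<Longrightarrow> mean_after b \<le> mean_after a"
  using integral_split[of a b] integral_nonneg_eta[of a b] by simp

lemma continuous_mean_after: "continuous_on {0..1} mean_after"
  using eta_integrable[of 0 1] by (intro indefinite_integral_continuous_1') simp

lemma mean_small_on_short_intervals:
  assumes "0 < e"
  obtains d where "0 < d"
    "\<And>a b. 0 \<le> a \<Longrightarrow> a \<le> b \<Longrightarrow> b \<le> 1 \<Longrightarrow> b < a + d \<Longrightarrow> integral {a..b} \<eta> < e"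
proof -
  have "uniformly_continuous_on {0..1} mean_after"
    by (rule compact_uniformly_continuous[OF continuous_mean_after]) simp
  then obtain d where d: "0 < d" "\<And>x y. x \<in> {0..1} \<Longrightarrow> y \<in> {0..1} \<Longrightarrow> dist y x < d \<Longrightarrow>
      dist (mean_after y) (mean_after x) < e"
    using assms unfolding uniformly_continuous_on_def by metis
  have "integral {a..b} \<eta> < e" if "0 \<le> a" "a \<le> b" "b \<le> 1" "b < a + d" for a b
    using d(2)[of b a] that integral_split[of a b] by (simp add: dist_real_def)
  then show ?thesis using that d(1) by blast
qed

definition threshold :: real where
  "threshold = Inf {s \<in> {0..1}. mean_after s \<le> 1}"

lemma threshold_range: "threshold \<in> {0..1}"
  and mean_after_le_one_iff: "s \<in> {0..1} \<Longrightarrow> mean_after s \<le> 1 \<longleftrightarrow> threshold \<le> s"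
proof -
  define S where "S = {s \<in> {0..1}. mean_after s \<le> 1}"
  have one: "1 \<in> S" by (simp add: S_def)
  have bdd: "bdd_below S" by (auto simp: S_def bdd_below_def)
  have "closed S" unfolding S_def
    by (rule continuous_on_closed_Collect_le[OF continuous_mean_after]) auto
  then have mem: "threshold \<in> S"
    unfolding threshold_def S_def[symmetric] using one bdd by (intro closed_contains_Inf) auto
  then show "threshold \<in> {0..1}" by (simp add: S_def)
  show "mean_after s \<le> 1 \<longleftrightarrow> threshold \<le> s" if s: "s \<in> {0..1}"
  proof
    assume "mean_after s \<le> 1"
    then show "threshold \<le> s"
      unfolding threshold_def S_def[symmetric] using s by (intro cInf_lower bdd) (simp add: S_def)
  next
    assume "threshold \<le> s"
    then show "mean_after s \<le> 1"
      using mean_after_antimono[of threshold s] mem s by (simp add: S_def)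
  qed
qed

text \<open>
  A positive threshold means that more than one arrival is expected from time 0 on; by continuity the
  value 1 is then attained, and not before the threshold.
\<close>

lemma mean_after_threshold:
  assumes "0 < threshold"
  shows "mean_after threshold = 1"
proof -
  have "\<exists>x. 0 \<le> x \<and> x \<le> threshold \<and> mean_after x = 1"
    using threshold_range mean_after_le_one_iff[of 0] mean_after_le_one_iff[of threshold] assms
    by (intro IVT2' continuous_on_subset[OF continuous_mean_after]) auto
  then obtain x where x: "0 \<le> x" "x \<le> threshold" "mean_after x = 1" by blast
  then have "threshold \<le> x" using mean_after_le_one_iff[of x] threshold_range by simp
  then show ?thesis using x by simp
qed

section \<open>One remaining arrival against none\<close>

lemma increment_law_nonneg: "0 \<le> increment_law u t B"
  by (simp add: increment_law_def)

lemma increment_law_compl: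
  assumes "0 \<le> u" "u \<le> t" "t \<le> 1" "prob (started u) > 0"
  shows "increment_law u t (-B) = 1 - increment_law u t B"
proof -
  let ?E = "\<lambda>B. {\<omega> \<in> started u. C t \<omega> - C u \<omega> \<in> B}"
  have meas: "?E B \<in> sets M" for B
    using C_event[OF started_M, of u t u "\<lambda>i j. j - i \<in> B"] assms by simp
  have "prob (started u) = prob (?E B \<union> ?E (-B))"
    by (rule arg_cong[where f = prob]) auto
  also have "\<dots> = prob (?E B) + prob (?E (-B))"
    by (rule finite_measure_Union[OF meas meas]) auto
  finally show ?thesis
    using assms(4) by (simp add: increment_law_def field_simps)
qed

lemma increment_law_jump_le:
  assumes "0 \<le> u" "u \<le> t" "t \<le> 1" "prob (started u) > 0"
  shows "increment_law u t (-{0}) \<le> integral {u..t} \<eta>"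
proof -
  have "{\<omega> \<in> started u. C t \<omega> \<noteq> C u \<omega>} = {\<omega> \<in> space M. T \<omega> \<le> u \<and> C t \<omega> - C u \<omega> \<in> -{0}}"
    using counting_path.le[OF path, of _ u t] assms by force
  then show ?thesis
    using increment_prob_le[OF assms(1-3)] assms(4) by (simp add: increment_law_def field_simps)
qed

lemma card_occupied_cells_measurable:
  assumes "0 \<le> s" "s \<le> 1"
  shows "(\<lambda>\<omega>. card (occupied_cells (\<lambda>t. C t \<omega>) s n)) \<in> M \<rightarrow>\<^sub>M count_space UNIV"
proof -
  have "(\<lambda>\<omega>. \<Sum>k<n. if C (grid s n (Suc k)) \<omega> \<noteq> C (grid s n k) \<omega> then 1 else 0 :: nat)
      \<in> M \<rightarrow>\<^sub>M count_space UNIV"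
  proof (rule measurable_sum_nat)
    fix k assume "k \<in> {..<n}"
    then have "{\<omega> \<in> space M. C (grid s n (Suc k)) \<omega> \<noteq> C (grid s n k) \<omega>} \<in> sets M"
      using assms grid_bounds[of s n k] grid_bounds[of s n "Suc k"] by (intro C_event) auto
    then show "(\<lambda>\<omega>. if C (grid s n (Suc k)) \<omega> \<noteq> C (grid s n k) \<omega> then 1 else 0 :: nat)
        \<in> M \<rightarrow>\<^sub>M count_space UNIV"
      by (intro measurable_If) auto
  qed
  then show ?thesis by (simp add: card_occupied_cells)
qed

text \<open>
  For every path the number of occupied cells eventually equals the number of arrivals after \<open>s\<close>, and it
  is bounded by the integrable variable \<open>C 1\<close>.
\<close>

lemma occupied_cells_limit:
  fixes g :: "nat \<Rightarrow> real"
  assumes s: "0 \<le> s" "s \<le> 1" and g: "\<And>j. \<bar>g j\<bar> \<le> real j"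
  shows "(\<lambda>n. \<integral>\<omega>. indicator (started s) \<omega> * g (card (occupied_cells (\<lambda>t. C t \<omega>) s n)) \<partial>M)
    \<longlonglongrightarrow> (\<integral>\<omega>. indicator (started s) \<omega> * g (C 1 \<omega> - C s \<omega>) \<partial>M)"
proof (rule integral_dominated_convergence[where w = "\<lambda>\<omega>. real (C 1 \<omega>)"])
  note [measurable] = card_occupied_cells_measurable[OF s]
  have [measurable]: "C 1 \<in> M \<rightarrow>\<^sub>M count_space UNIV" "C s \<in> M \<rightarrow>\<^sub>M count_space UNIV"
    using s by auto
  show "(\<lambda>\<omega>. indicator (started s) \<omega> * g (C 1 \<omega> - C s \<omega>)) \<in> borel_measurable M"
    by measurable
  show "(\<lambda>\<omega>. indicator (started s) \<omega> * g (card (occupied_cells (\<lambda>t. C t \<omega>) s n)))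
      \<in> borel_measurable M" for n
    by measurable
  show "integrable M (\<lambda>\<omega>. real (C 1 \<omega>))" by (rule integrable_C)
  show "AE \<omega> in M. (\<lambda>n. indicator (started s) \<omega> * g (card (occupied_cells (\<lambda>t. C t \<omega>) s n)))
      \<longlonglongrightarrow> indicator (started s) \<omega> * g (C 1 \<omega> - C s \<omega>)"
  proof (rule AE_I2)
    fix \<omega> assume "\<omega> \<in> space M"
    then have "eventually (\<lambda>n. card (occupied_cells (\<lambda>t. C t \<omega>) s n) = C 1 \<omega> - C s \<omega>) sequentially"
      using counting_path.eventually_card_occupied_cells[OF path s] by simp
    then have "eventually (\<lambda>n. indicator (started s) \<omega> * g (card (occupied_cells (\<lambda>t. C t \<omega>) s n))
        = indicator (started s) \<omega> * g (C 1 \<omega> - C s \<omega>)) sequentially"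
      by (rule eventually_mono) simp
    then show "(\<lambda>n. indicator (started s) \<omega> * g (card (occupied_cells (\<lambda>t. C t \<omega>) s n)))
      \<longlonglongrightarrow> indicator (started s) \<omega> * g (C 1 \<omega> - C s \<omega>)"
      by (rule tendsto_eventually)
  qed
  show "AE \<omega> in M. norm (indicator (started s) \<omega> * g (card (occupied_cells (\<lambda>t. C t \<omega>) s n)))
      \<le> real (C 1 \<omega>)" for n
  proof (rule AE_I2)
    fix \<omega> assume \<omega>: "\<omega> \<in> space M"
    have "card (occupied_cells (\<lambda>t. C t \<omega>) s n) \<le> C 1 \<omega>"
    proof (cases "n = 0")
      case True
      then show ?thesis by (simp add: occupied_cells_def)
    next
      case False
      then show ?thesis
        using counting_path.card_occupied_cells_le[OF path[OF \<omega>] s, of n] by simp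
    qed
    then show "norm (indicator (started s) \<omega> * g (card (occupied_cells (\<lambda>t. C t \<omega>) s n)))
      \<le> real (C 1 \<omega>)"
      using g[of "card (occupied_cells (\<lambda>t. C t \<omega>) s n)"] by (auto split: split_indicator)
  qed
qed

text \<open>
  Replacing the event that cell \<open>k\<close> is occupied by the event that it is empty changes only the middle
  one of three independent factors (past, cell, future), from \<open>p\<close> to \<open>1 - p\<close>.
\<close>

lemma single_cell_balance:
  assumes s: "0 \<le> s" "s \<le> 1" "prob (started s) > 0" and k: "k < n"
  defines "p \<equiv> increment_law (grid s n k) (grid s n (Suc k)) (-{0})"
  shows "prob {\<omega> \<in> started s. occupied_cells (\<lambda>t. C t \<omega>) s n = {k}} * (1 - p)
    = p * prob {\<omega> \<in> started s. C 1 \<omega> = C s \<omega>}"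
proof -
  define u v where "u = grid s n k" and "v = grid s n (Suc k)"
  have uv: "s \<le> u" "u \<le> v" "v \<le> 1"
    using grid_bounds[of s n k] grid_bounds[of s n "Suc k"] grid_mono[of s k "Suc k" n] s k
    by (auto simp: u_def v_def)
  define A where "A = {\<omega> \<in> started s. C u \<omega> = C s \<omega>}"
  define A' where "A' B = {\<omega> \<in> A. C v \<omega> - C u \<omega> \<in> B}" for B
  have sub: "A \<subseteq> started u" "A' B \<subseteq> started v" for B
    using uv by (auto simp: A_def A'_def)
  have A: "A \<in> sets (F u)"
    unfolding A_def using uv s by (intro C_event_F started_F) auto
  have A': "A' B \<in> sets (F v)" for B
    unfolding A'_def using uv s F_subalgebra[OF \<open>u \<le> v\<close> A] by (intro C_event_F) auto
  have probs: "prob {\<omega> \<in> A' B. C 1 \<omega> - C v \<omega> \<in> {0}}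
      = prob A * increment_law u v B * increment_law v 1 {0}" for B
    using increment_law[OF A' sub(2), of 1 B "{0}"] increment_law[OF A sub(1), of v B] uv s
    by (simp add: A'_def)
  have le: "C s \<omega> \<le> C u \<omega>" "C u \<omega> \<le> C v \<omega>" "C v \<omega> \<le> C 1 \<omega>" if "\<omega> \<in> space M" for \<omega>
    using counting_path.le[OF path[OF that]] uv s by auto
  have "{\<omega> \<in> started s. occupied_cells (\<lambda>t. C t \<omega>) s n = {k}}
      = {\<omega> \<in> A' (-{0}). C 1 \<omega> - C v \<omega> \<in> {0}}"
    using counting_path.occupied_cells_eq_singleton_iff[OF path s(1,2) k] le
    by (fastforce simp: A_def A'_def u_def[symmetric] v_def[symmetric])
  moreover have "{\<omega> \<in> started s. C 1 \<omega> = C s \<omega>} = {\<omega> \<in> A' {0}. C 1 \<omega> - C v \<omega> \<in> {0}}"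
    using le by (fastforce simp: A_def A'_def)
  moreover have "increment_law u v {0} = 1 - p"
  proof -
    have "prob (started s) \<le> prob (started u)"
      using uv by (intro finite_measure_mono) auto
    then show ?thesis
      using increment_law_compl[of u v "{0}"] s uv by (simp add: p_def u_def v_def)
  qed
  ultimately show ?thesis
    by (simp only: probs) (simp add: p_def u_def[symmetric] v_def[symmetric])
qed

text \<open>
  For a Poisson variable this is the ratio of the masses at 1 and at 0.
  With \<open>e\<^sub>k\<close> the probability that only cell \<open>k\<close> is occupied, the balance for single cells sums up to
  \<open>\<Sum>e\<^sub>k - P(none) * \<Sum>p\<^sub>k = \<Sum>e\<^sub>k * p\<^sub>k\<close>. Here \<open>\<Sum>e\<^sub>k\<close> tends to the probability of exactly one
  arrival and \<open>\<Sum>p\<^sub>k\<close> to its mean, while the right-hand side is at most \<open>max p\<^sub>k\<close>, which tends to 0 by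
  uniform continuity of the integral of \<open>\<eta>\<close>.
\<close>

lemma increment_law_one:
  assumes s: "0 \<le> s" "s \<le> 1"
  shows "increment_law s 1 {1} = mean_after s * increment_law s 1 {0}"
proof (cases "prob (started s) = 0")
  case True
  then show ?thesis by (simp add: increment_law_def)
next
  case False
  then have pos: "prob (started s) > 0" by (simp add: zero_less_measure_iff)
  define p where "p n k = increment_law (grid s n k) (grid s n (Suc k)) (-{0})" for n k
  define e where "e n k = prob {\<omega> \<in> started s. occupied_cells (\<lambda>t. C t \<omega>) s n = {k}}" for n k
  define none where "none = prob {\<omega> \<in> started s. C 1 \<omega> = C s \<omega>}"
  define one where "one = prob {\<omega> \<in> started s. C 1 \<omega> - C s \<omega> = 1}"
  let ?occ = "\<lambda>n \<omega>. occupied_cells (\<lambda>t. C t \<omega>) s n"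
  note [measurable] = card_occupied_cells_measurable[OF s]
  have g01: "0 \<le> grid s n k" "grid s n k \<le> grid s n (Suc k)" "grid s n (Suc k) \<le> 1"
      "s \<le> grid s n k" if "k < n" for n k
    using grid_bounds[of s n k] grid_bounds[of s n "Suc k"] grid_mono[of s k "Suc k" n] s that by auto
  have cell_event: "{\<omega> \<in> started s. C (grid s n (Suc k)) \<omega> \<noteq> C (grid s n k) \<omega>} \<in> sets M"
    if "k < n" for n k
    using g01[OF that] by (intro C_event started_M) auto
  have ind: "(\<integral>\<omega>. indicator (started s) \<omega> * (if P \<omega> then 1 else 0 :: real) \<partial>M)
      = prob {\<omega> \<in> started s. P \<omega>}" for P
  proof -
    have "(\<integral>\<omega>. indicator (started s) \<omega> * (if P \<omega> then 1 else 0 :: real) \<partial>M)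
        = (\<integral>\<omega>. indicator {\<omega> \<in> started s. P \<omega>} \<omega> \<partial>M)"
      by (intro Bochner_Integration.integral_cong) (auto split: split_indicator)
    also have "\<dots> = prob ({\<omega> \<in> started s. P \<omega>} \<inter> space M)" by simp
    also have "{\<omega> \<in> started s. P \<omega>} \<inter> space M = {\<omega> \<in> started s. P \<omega>}" by auto
    finally show ?thesis .
  qed

  have sum_p: "(\<lambda>n. \<Sum>k<n. p n k) \<longlonglongrightarrow> mean_after s"
  proof -
    have eq: "(\<integral>\<omega>. indicator (started s) \<omega> * real (card (?occ n \<omega>)) \<partial>M)
        = prob (started s) * (\<Sum>k<n. p n k)" for n
    proof -
      have "(\<integral>\<omega>. indicator (started s) \<omega> * real (card (?occ n \<omega>)) \<partial>M)
          = (\<integral>\<omega>. (\<Sum>k<n. indicator {\<omega> \<in> started s. C (grid s n (Suc k)) \<omega> \<noteq> C (grid s n k) \<omega>} \<omega>) \<partial>M)"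
      proof (rule Bochner_Integration.integral_cong[OF refl])
        fix \<omega>
        have "real (card (?occ n \<omega>))
            = (\<Sum>k<n. if C (grid s n (Suc k)) \<omega> \<noteq> C (grid s n k) \<omega> then 1 else 0)"
          unfolding card_occupied_cells of_nat_sum by (intro sum.cong) auto
        then show "indicator (started s) \<omega> * real (card (?occ n \<omega>))
          = (\<Sum>k<n. indicator {\<omega> \<in> started s. C (grid s n (Suc k)) \<omega> \<noteq> C (grid s n k) \<omega>} \<omega>)"
          by (cases "\<omega> \<in> started s") (auto simp del: sum.If_cases intro!: sum.cong)
      qed
      also have "\<dots> = (\<Sum>k<n. prob {\<omega> \<in> started s. C (grid s n (Suc k)) \<omega> \<noteq> C (grid s n k) \<omega>})"
      proof (subst Bochner_Integration.integral_sum)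
        fix k assume "k \<in> {..<n}"
        then show "integrable M (indicator {\<omega> \<in> started s. C (grid s n (Suc k)) \<omega> \<noteq> C (grid s n k) \<omega>}
            :: 'a \<Rightarrow> real)"
          using cell_event[of k n]
          by (intro integrable_real_indicator) (auto simp: emeasure_eq_measure)
      next
        show "(\<Sum>k<n. \<integral>\<omega>. indicator {\<omega> \<in> started s. C (grid s n (Suc k)) \<omega> \<noteq> C (grid s n k) \<omega>} \<omega> \<partial>M)
          = (\<Sum>k<n. prob {\<omega> \<in> started s. C (grid s n (Suc k)) \<omega> \<noteq> C (grid s n k) \<omega>})"
        proof (rule sum.cong[OF refl])
          fix k
          let ?J = "{\<omega> \<in> started s. C (grid s n (Suc k)) \<omega> \<noteq> C (grid s n k) \<omega>}"
          have "?J \<inter> space M = ?J" by auto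
          then show "(\<integral>\<omega>. indicator ?J \<omega> \<partial>M) = prob ?J"
            by (simp only: Bochner_Integration.integral_indicator)
        qed
      qed
      also have "\<dots> = (\<Sum>k<n. prob (started s) * p n k)"
      proof (rule sum.cong[OF refl])
        fix k assume "k \<in> {..<n}"
        then have k: "k < n" by simp
        have "{\<omega> \<in> started s. C (grid s n (Suc k)) \<omega> \<noteq> C (grid s n k) \<omega>}
            = {\<omega> \<in> started s. C (grid s n (Suc k)) \<omega> - C (grid s n k) \<omega> \<in> -{0}}"
          using counting_path.le[OF path, of _ "grid s n k" "grid s n (Suc k)"] g01[OF k] by force
        also have "prob \<dots> = prob (started s) * p n k"
          unfolding p_def using g01[OF k] by (intro increment_law started_F) auto
        finally show "prob {\<omega> \<in> started s. C (grid s n (Suc k)) \<omega> \<noteq> C (grid s n k) \<omega>}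
            = prob (started s) * p n k" .
      qed
      finally show ?thesis by (simp add: sum_distrib_left)
    qed
    have "(\<lambda>n. prob (started s) * (\<Sum>k<n. p n k)) \<longlonglongrightarrow> prob (started s) * mean_after s"
      using occupied_cells_limit[OF s, of real] expected_increment[OF s order_refl]
      unfolding eq by simp
    then show ?thesis using pos by (simp add: tendsto_mult_left_iff)
  qed

  have sum_e: "(\<Sum>k<n. e n k) = prob {\<omega> \<in> started s. card (?occ n \<omega>) = 1}" for n
  proof -
    have occ_sub: "?occ n \<omega> \<subseteq> {..<n}" for \<omega> by (auto simp: occupied_cells_def)
    have "{\<omega> \<in> started s. card (?occ n \<omega>) = 1}
        = (\<Union>k\<in>{..<n}. {\<omega> \<in> started s. ?occ n \<omega> = {k}})"
      using occ_sub by (fastforce simp: card_1_singleton_iff)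
    also have "prob \<dots> = (\<Sum>k<n. e n k)"
      unfolding e_def
    proof (rule finite_measure_finite_Union)
      show "(\<lambda>k. {\<omega> \<in> started s. ?occ n \<omega> = {k}}) ` {..<n} \<subseteq> sets M"
      proof (rule image_subsetI)
        fix k assume "k \<in> {..<n}"
        then have k: "k < n" by simp
        have "{\<omega> \<in> started s. ?occ n \<omega> = {k}}
            = {\<omega> \<in> {\<omega> \<in> {\<omega> \<in> started s. C (grid s n k) \<omega> = C s \<omega>}.
                  C (grid s n (Suc k)) \<omega> \<noteq> C (grid s n k) \<omega>}. C 1 \<omega> = C (grid s n (Suc k)) \<omega>}"
          using counting_path.occupied_cells_eq_singleton_iff[OF path s k] by auto
        also have "\<dots> \<in> sets M" using g01[OF k] s by (intro C_event started_M) auto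
        finally show "{\<omega> \<in> started s. ?occ n \<omega> = {k}} \<in> sets M" .
      qed
      show "disjoint_family_on (\<lambda>k. {\<omega> \<in> started s. ?occ n \<omega> = {k}}) {..<n}"
        by (auto simp: disjoint_family_on_def)
    qed simp
    finally show ?thesis by simp
  qed
  have lim_e: "(\<lambda>n. \<Sum>k<n. e n k) \<longlonglongrightarrow> one"
    using occupied_cells_limit[OF s, of "\<lambda>j. if j = 1 then 1 else 0"]
    unfolding sum_e one_def ind by simp

  have balance: "(\<Sum>k<n. e n k) - none * (\<Sum>k<n. p n k) = (\<Sum>k<n. e n k * p n k)" for n
  proof -
    have "none * p n k = e n k * (1 - p n k)" if "k < n" for k
      using single_cell_balance[OF s pos that] unfolding e_def p_def none_def by (simp add: mult.commute)
    then have "none * (\<Sum>k<n. p n k) = (\<Sum>k<n. e n k * (1 - p n k))"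
      unfolding sum_distrib_left by (intro sum.cong) auto
    then show ?thesis by (simp add: algebra_simps sum_subtractf)
  qed
  have small: "(\<lambda>n. \<Sum>k<n. e n k * p n k) \<longlonglongrightarrow> 0"
  proof (rule LIMSEQ_I)
    fix r :: real assume "0 < r"
    then obtain d where d: "0 < d"
      "\<And>a b. 0 \<le> a \<Longrightarrow> a \<le> b \<Longrightarrow> b \<le> 1 \<Longrightarrow> b < a + d \<Longrightarrow> integral {a..b} \<eta> < r / 2"
      using mean_small_on_short_intervals[of "r / 2"] by (metis half_gt_zero)
    have "eventually (\<lambda>n. (1 - s) / real n < d) sequentially"
      using order_tendstoD(2)[OF lim_const_over_n d(1)] .
    moreover have "eventually (\<lambda>n::nat. 0 < n) sequentially" by (rule eventually_gt_at_top)
    ultimately have "eventually (\<lambda>n. norm ((\<Sum>k<n. e n k * p n k) - 0) < r) sequentially"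
    proof eventually_elim
      case (elim n)
      have p_le: "p n k \<le> r / 2" if k: "k < n" for k
      proof -
        have "prob (started s) \<le> prob (started (grid s n k))"
          using g01[OF k] by (intro finite_measure_mono) auto
        then have "p n k \<le> integral {grid s n k..grid s n (Suc k)} \<eta>"
          unfolding p_def using pos g01[OF k] by (intro increment_law_jump_le) auto
        also have "\<dots> < r / 2"
          using g01[OF k] elim grid_step[of n s k] by (intro d(2)) auto
        finally show ?thesis by simp
      qed
      have "(\<Sum>k<n. e n k * p n k) \<le> (\<Sum>k<n. e n k * (r / 2))"
        using p_le by (intro sum_mono mult_left_mono) (auto simp: e_def)
      also have "\<dots> = (\<Sum>k<n. e n k) * (r / 2)" by (simp add: sum_distrib_right)
      also have "\<dots> \<le> 1 * (r / 2)"
        using \<open>0 < r\<close> by (intro mult_right_mono) (simp_all add: sum_e)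
      finally have "(\<Sum>k<n. e n k * p n k) < r" using \<open>0 < r\<close> by simp
      moreover have "0 \<le> (\<Sum>k<n. e n k * p n k)"
        by (intro sum_nonneg mult_nonneg_nonneg) (auto simp: e_def p_def increment_law_nonneg)
      ultimately show ?case by simp
    qed
    then show "\<exists>no. \<forall>n\<ge>no. norm ((\<Sum>k<n. e n k * p n k) - 0) < r"
      by (simp add: eventually_sequentially)
  qed
  have "(\<lambda>n. (\<Sum>k<n. e n k) - none * (\<Sum>k<n. p n k)) \<longlonglongrightarrow> one - none * mean_after s"
    by (intro tendsto_intros lim_e sum_p)
  then have "one - none * mean_after s = 0"
    using small unfolding balance by (rule LIMSEQ_unique)
  moreover have "{\<omega> \<in> space M. T \<omega> \<le> s \<and> C 1 \<omega> - C s \<omega> \<in> {0}} = {\<omega> \<in> started s. C 1 \<omega> = C s \<omega>}"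
    using counting_path.le[OF path, of _ s 1] s by force
  ultimately show ?thesis
    by (simp add: increment_law_def one_def none_def)
qed

lemma one_arrival_vs_none:
  assumes A: "A \<in> sets (F s)" "A \<subseteq> started s" and s: "0 \<le> s" "s \<le> 1"
  shows "prob {\<omega> \<in> A. C 1 \<omega> = C s \<omega> + 1} = mean_after s * prob {\<omega> \<in> A. C 1 \<omega> = C s \<omega>}"
proof -
  have le: "C s \<omega> \<le> C 1 \<omega>" if "\<omega> \<in> A" for \<omega>
    using counting_path.le[OF path, of \<omega> s 1] s that A(2) by auto
  have "{\<omega> \<in> A. C 1 \<omega> = C s \<omega> + 1} = {\<omega> \<in> A. C 1 \<omega> - C s \<omega> \<in> {1}}"
    "{\<omega> \<in> A. C 1 \<omega> = C s \<omega>} = {\<omega> \<in> A. C 1 \<omega> - C s \<omega> \<in> {0}}"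
    using le by force+
  then show ?thesis
    using increment_law[OF A, of 1 "{1}"] increment_law[OF A, of 1 "{0}"] s increment_law_one[OF s]
    by (simp only: mult.left_commute)
qed

section \<open>Strategies and their success events\<close>

abbreviation first_selectable :: "'a \<Rightarrow> real" where
  "first_selectable \<equiv> first_selectable_arrival C T \<eta>"

lemma selectable_iff:
  assumes "\<omega> \<in> space M"
  shows "selectable_arrival C T \<eta> \<omega> t \<longleftrightarrow> jump (\<lambda>t. C t \<omega>) t \<and> T \<omega> \<le> t \<and> threshold \<le> t"
  unfolding selectable_arrival_def arrival_iff_jump[OF assms]
  using mean_after_le_one_iff[of t] by (auto simp: jump_def)

lemma first_selectable_least:
  assumes \<omega>: "\<omega> \<in> space M" and t: "jump (\<lambda>t. C t \<omega>) t" "T \<omega> \<le> t" "threshold \<le> t"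
  shows "jump (\<lambda>t. C t \<omega>) (first_selectable \<omega>)" "T \<omega> \<le> first_selectable \<omega>"
    "threshold \<le> first_selectable \<omega>" "first_selectable \<omega> \<le> t"
proof -
  interpret c: counting_path "\<lambda>t. C t \<omega>" by (rule path[OF \<omega>])
  have "selectable_arrival C T \<eta> \<omega> t" using t selectable_iff[OF \<omega>] by simp
  then obtain r where r: "selectable_arrival C T \<eta> \<omega> r"
    "\<And>t. selectable_arrival C T \<eta> \<omega> t \<Longrightarrow> r \<le> t"
    using c.first_jump_exists[of t "selectable_arrival C T \<eta> \<omega>"] t(1) selectable_iff[OF \<omega>] by metis
  have "first_selectable \<omega> = r"
    unfolding first_selectable_arrival_def using r by (auto intro: Least_equality)
  then show "jump (\<lambda>t. C t \<omega>) (first_selectable \<omega>)" "T \<omega> \<le> first_selectable \<omega>"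
    "threshold \<le> first_selectable \<omega>" "first_selectable \<omega> \<le> t"
    using r \<open>selectable_arrival C T \<eta> \<omega> t\<close> selectable_iff[OF \<omega>] by auto
qed

lemma first_selectable_stops:
  assumes \<omega>: "\<omega> \<in> space M" and "first_selectable \<omega> \<le> 1"
  shows "jump (\<lambda>t. C t \<omega>) (first_selectable \<omega>)" "T \<omega> \<le> first_selectable \<omega>"
    "threshold \<le> first_selectable \<omega>"
proof -
  have "\<exists>t. selectable_arrival C T \<eta> \<omega> t"
    using assms(2) by (rule contrapos_pp) (simp add: first_selectable_arrival_def no_stop_def)
  then obtain t where "jump (\<lambda>t. C t \<omega>) t" "T \<omega> \<le> t" "threshold \<le> t"
    using selectable_iff[OF \<omega>] by blast
  from first_selectable_least[OF \<omega> this]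
  show "jump (\<lambda>t. C t \<omega>) (first_selectable \<omega>)" "T \<omega> \<le> first_selectable \<omega>"
    "threshold \<le> first_selectable \<omega>" by auto
qed

lemma first_selectable_range:
  assumes "\<omega> \<in> space M"
  shows "first_selectable \<omega> \<in> {T \<omega>..1} \<union> {no_stop}"
proof (cases "\<exists>t. selectable_arrival C T \<eta> \<omega> t")
  case True
  then obtain t where "jump (\<lambda>t. C t \<omega>) t" "T \<omega> \<le> t" "threshold \<le> t"
    using selectable_iff[OF assms] by blast
  from first_selectable_least[OF assms this] show ?thesis by (auto simp: jump_def)
qed (simp add: first_selectable_arrival_def)

text \<open>
  The last jump up to \<open>t\<close> is selectable unless the path already has its value \<open>C t\<close> at some rational time
  before the start \<open>max (T \<omega>) threshold\<close> of the selection period. The condition involves only the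
  history up to \<open>t\<close>, at countably many times, which makes the first selectable arrival a stopping time.
\<close>

lemma first_selectable_le_iff:
  assumes \<omega>: "\<omega> \<in> space M" and t: "0 \<le> t" "t \<le> 1"
  shows "first_selectable \<omega> \<le> t \<longleftrightarrow> T \<omega> \<le> t \<and> threshold \<le> t \<and> C 0 \<omega> < C t \<omega> \<and>
    (\<forall>q\<in>\<rat> \<inter> {0..<t}. \<not> (T \<omega> \<le> q \<and> threshold \<le> q) \<longrightarrow> C q \<omega> < C t \<omega>)" (is "_ \<longleftrightarrow> ?R")
proof
  interpret c: counting_path "\<lambda>t. C t \<omega>" by (rule path[OF \<omega>])
  let ?\<tau> = "first_selectable \<omega>"
  {
    assume le: "?\<tau> \<le> t"
    then have \<tau>: "jump (\<lambda>t. C t \<omega>) ?\<tau>" "T \<omega> \<le> ?\<tau>" "threshold \<le> ?\<tau>"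
      using first_selectable_stops[OF \<omega>] t by auto
    have "C ?\<tau> \<omega> \<le> C t \<omega>" using c.le[of ?\<tau> t] le t \<tau>(1) by (auto simp: jump_def)
    moreover have "C q \<omega> < C ?\<tau> \<omega>" if "0 \<le> q" "q < ?\<tau>" for q
      using c.jump_less[OF \<tau>(1)] that by simp
    moreover have "0 < ?\<tau>" using \<tau>(1) by (simp add: jump_def)
    ultimately show ?R using \<tau> le by (force intro: less_le_trans)
  }
  assume R: ?R
  then obtain K where K: "K \<le> t" "jump (\<lambda>t. C t \<omega>) K" "C K \<omega> = C t \<omega>"
    using c.level_reached_by_jump[of 0 t "C t \<omega>"] t by auto
  have "max (T \<omega>) threshold \<le> K"
  proof (rule ccontr)
    assume "\<not> ?thesis"
    then have "K < max (T \<omega>) threshold" by linarith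
    then obtain q where q: "q \<in> \<rat>" "K < q" "q < max (T \<omega>) threshold"
      using Rats_dense_in_real by blast
    then have "q \<in> \<rat> \<inter> {0..<t}" "\<not> (T \<omega> \<le> q \<and> threshold \<le> q)"
      using R K(2) by (auto simp: jump_def)
    then have "C q \<omega> < C K \<omega>" using R K(3) by metis
    moreover have "C K \<omega> \<le> C q \<omega>"
      using c.le[of K q] q K(2) \<open>q \<in> \<rat> \<inter> {0..<t}\<close> t by (auto simp: jump_def)
    ultimately show False by simp
  qed
  then show "?\<tau> \<le> t" using first_selectable_least(4)[OF \<omega> K(2)] K(1) by simp
qed

lemma stopping_first_selectable: "stopping_time F first_selectable"
proof
  fix t :: real
  have main: "{\<omega> \<in> space M. first_selectable \<omega> \<le> s} \<in> sets (F s)" if s: "0 \<le> s" "s \<le> 1" for s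
  proof -
    define Q where "Q = {q \<in> \<rat>. 0 \<le> q \<and> q < s}"
    have "countable Q" unfolding Q_def by (rule countable_subset[OF _ countable_rat]) auto
    let ?B = "\<lambda>q. {\<omega> \<in> space M - (if threshold \<le> q then started q else {}). C s \<omega> \<le> C q \<omega>}"
    have top: "space M \<in> sets (F s)" using sets.top[of "F s"] by (simp add: space_F)
    have "?B q \<in> sets (F s)" if "q \<in> Q" for q
      using that s top started_F[of q s] by (intro C_event_F) (auto simp: Q_def)
    then have B: "(\<Union>q\<in>Q. ?B q) \<in> sets (F s)"
      using \<open>countable Q\<close> by (intro sets.countable_UN'')
    let ?A = "{\<omega> \<in> (if threshold \<le> s then started s else {}). C 0 \<omega> < C s \<omega>}"
    have A: "?A \<in> sets (F s)"
      using started_F[of s s] s by (intro C_event_F) auto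
    have "{\<omega> \<in> space M. first_selectable \<omega> \<le> s} = ?A - (\<Union>q\<in>Q. ?B q)"
    proof (rule set_eqI)
      fix \<omega>
      show "\<omega> \<in> {\<omega> \<in> space M. first_selectable \<omega> \<le> s} \<longleftrightarrow> \<omega> \<in> ?A - (\<Union>q\<in>Q. ?B q)"
      proof (cases "\<omega> \<in> space M")
        case True
        show ?thesis
          using True by (auto simp: first_selectable_le_iff[OF True s] Q_def not_less split: if_splits)
      qed (auto split: if_splits)
    qed
    then show ?thesis using sets.Diff[OF A B] by simp
  qed
  have "{\<omega> \<in> space M. first_selectable \<omega> \<le> t} \<in> sets (F t)"
  proof -
    \<comment> \<open>the only value outside \<open>[0, 1]\<close> is \<open>no_stop = 2\<close>\<close>
    consider "t < 0" | "0 \<le> t" "t < 2" | "2 \<le> t" by linarith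
    then show ?thesis
    proof cases
      case 1
      have "{\<omega> \<in> space M. first_selectable \<omega> \<le> t} = {}"
      proof -
        have "\<not> first_selectable \<omega> \<le> t" if "\<omega> \<in> space M" for \<omega>
          using first_selectable_range[OF that] T_range[OF that] 1 by (auto simp: no_stop_def)
        then show ?thesis by blast
      qed
      then show ?thesis by (simp only: sets.empty_sets)
    next
      case 2
      have eq: "{\<omega> \<in> space M. first_selectable \<omega> \<le> t} = {\<omega> \<in> space M. first_selectable \<omega> \<le> min t 1}"
      proof -
        have "first_selectable \<omega> \<le> t \<longleftrightarrow> first_selectable \<omega> \<le> min t 1" if "\<omega> \<in> space M" for \<omega>
        proof -
          have "first_selectable \<omega> \<le> 1 \<or> first_selectable \<omega> = 2"
            using first_selectable_range[OF that] unfolding no_stop_def by auto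
          then show ?thesis using 2 by linarith
        qed
        then show ?thesis by blast
      qed
      show ?thesis unfolding eq using 2 by (intro F_subalgebra[OF _ main]) auto
    next
      case 3
      have "{\<omega> \<in> space M. first_selectable \<omega> \<le> t} = space (F t)"
      proof -
        have "first_selectable \<omega> \<le> t" if "\<omega> \<in> space M" for \<omega>
          using first_selectable_range[OF that] 3 by (auto simp: no_stop_def)
        then show ?thesis unfolding space_F by blast
      qed
      then show ?thesis by (simp only: sets.top)
    qed
  qed
  then show "Measurable.pred (F t) (\<lambda>\<omega>. first_selectable \<omega> \<le> t)"
    by (simp add: pred_def space_F)
qed

lemma admissible_first_selectable: "admissible_strategy F (space M) T first_selectable"
  using stopping_first_selectable first_selectable_range by (auto simp: admissible_strategy_def)

lemma success_iff:
  assumes "\<omega> \<in> space M"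
  shows "\<omega> \<in> success_event (space M) C \<sigma> \<longleftrightarrow>
    jump (\<lambda>t. C t \<omega>) (\<sigma> \<omega>) \<and> C (\<sigma> \<omega>) \<omega> = C 1 \<omega>"
  using counting_path.last_jump_iff[OF path[OF assms]] assms
  by (auto simp: success_event_def arrival_iff_jump)

text \<open>
  The last arrival is the only time before which the path is below its final value and after which it
  has its final value; rational times suffice to test this.
\<close>

lemma success_rational_iff:
  assumes \<omega>: "\<omega> \<in> space M" and "0 \<le> \<sigma> \<omega>"
  shows "\<omega> \<in> success_event (space M) C \<sigma> \<longleftrightarrow> \<sigma> \<omega> \<le> 1 \<and> C 0 \<omega> < C 1 \<omega> \<and>
    (\<forall>q\<in>\<rat> \<inter> {0..1}. (q < \<sigma> \<omega> \<longrightarrow> C q \<omega> \<noteq> C 1 \<omega>) \<and> (\<sigma> \<omega> < q \<longrightarrow> C q \<omega> = C 1 \<omega>))"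
    (is "_ \<longleftrightarrow> ?R")
proof
  interpret c: counting_path "\<lambda>t. C t \<omega>" by (rule path[OF \<omega>])
  {
    assume "\<omega> \<in> success_event (space M) C \<sigma>"
    then have \<sigma>: "jump (\<lambda>t. C t \<omega>) (\<sigma> \<omega>)" "C (\<sigma> \<omega>) \<omega> = C 1 \<omega>"
      using success_iff[OF \<omega>] by auto
    have after: "C q \<omega> = C 1 \<omega>" if "\<sigma> \<omega> < q" "q \<le> 1" for q
      using c.le[of "\<sigma> \<omega>" q] c.le[of q 1] \<sigma> that by (auto simp: jump_def)
    have before: "C q \<omega> < C 1 \<omega>" if "0 \<le> q" "q < \<sigma> \<omega>" for q
      using c.jump_less[OF \<sigma>(1) that] \<sigma>(2) by simp
    have range: "0 < \<sigma> \<omega>" "\<sigma> \<omega> \<le> 1" using \<sigma>(1) by (auto simp: jump_def)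
    show ?R
    proof (intro conjI ballI impI)
      show "\<sigma> \<omega> \<le> 1" "C 0 \<omega> < C 1 \<omega>" using range before[of 0] by auto
    next
      fix q assume "q \<in> \<rat> \<inter> {0..1}" "q < \<sigma> \<omega>"
      then show "C q \<omega> \<noteq> C 1 \<omega>" using before[of q] by auto
    next
      fix q assume "q \<in> \<rat> \<inter> {0..1}" "\<sigma> \<omega> < q"
      then show "C q \<omega> = C 1 \<omega>" using after[of q] by auto
    qed
  }
  assume R: ?R
  then obtain L where L: "jump (\<lambda>t. C t \<omega>) L" "C L \<omega> = C 1 \<omega>"
    using c.last_jump_exists by force
  have "\<not> \<sigma> \<omega> < L"
  proof
    assume "\<sigma> \<omega> < L"
    then obtain q where q: "q \<in> \<rat>" "\<sigma> \<omega> < q" "q < L" using Rats_dense_in_real by blast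
    then have "C q \<omega> < C 1 \<omega>" using c.jump_less[OF L(1), of q] L(2) assms(2) by simp
    moreover have "q \<in> \<rat> \<inter> {0..1}" using q L(1) assms(2) by (auto simp: jump_def)
    ultimately show False using R q(2) by (metis less_irrefl)
  qed
  moreover have "\<not> L < \<sigma> \<omega>"
  proof
    assume "L < \<sigma> \<omega>"
    then obtain q where q: "q \<in> \<rat>" "L < q" "q < \<sigma> \<omega>" using Rats_dense_in_real by blast
    then have "q \<in> \<rat> \<inter> {0..1}" using L(1) R by (auto simp: jump_def)
    moreover from this have "C q \<omega> = C 1 \<omega>"
      using c.le[of L q] c.le[of q 1] q L by (auto simp: jump_def)
    ultimately show False using R q(3) by blast
  qed
  ultimately have "\<sigma> \<omega> = L" by simp
  then show "\<omega> \<in> success_event (space M) C \<sigma>" using L success_iff[OF \<omega>] by simp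
qed

lemma stopped_before_event:
  assumes "admissible_strategy F (space M) T \<sigma>"
  shows "{\<omega> \<in> space M. \<sigma> \<omega> < t} \<in> sets (F t)"
proof -
  have "countable {q \<in> \<rat>. q < t}" by (rule countable_subset[OF _ countable_rat]) auto
  then have "(\<Union>q\<in>{q \<in> \<rat>. q < t}. {\<omega> \<in> space M. \<sigma> \<omega> \<le> q}) \<in> sets (F t)"
    using assms by (intro sets.countable_UN'' stopped_by) (auto simp: admissible_strategy_def)
  moreover have "(\<Union>q\<in>{q \<in> \<rat>. q < t}. {\<omega> \<in> space M. \<sigma> \<omega> \<le> q}) = {\<omega> \<in> space M. \<sigma> \<omega> < t}"
    using Rats_dense_in_real[of "\<sigma> _" t] by (fastforce intro: less_imp_le)
  ultimately show ?thesis by simp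
qed

lemma admissible_measurable:
  "admissible_strategy F (space M) T \<sigma> \<Longrightarrow> \<sigma> \<in> borel_measurable M"
  using measurable_stopping_time[of F \<sigma> M] sets_F space_F by (auto simp: admissible_strategy_def)

lemma admissible_bounds:
  assumes "admissible_strategy F (space M) T \<sigma>" "\<omega> \<in> space M"
  shows "0 \<le> \<sigma> \<omega>" "T \<omega> \<le> \<sigma> \<omega>"
  using assms T_range[of \<omega>] by (auto simp: admissible_strategy_def no_stop_def)

lemma success_event_measurable:
  assumes adm: "admissible_strategy F (space M) T \<sigma>"
  shows "success_event (space M) C \<sigma> \<in> sets M"
proof -
  note [measurable] = admissible_measurable[OF adm]
  have Q: "countable (\<rat> \<inter> {0..1::real})" by (rule countable_subset[OF _ countable_rat]) auto
  let ?A = "{\<omega> \<in> {\<omega> \<in> space M. \<sigma> \<omega> \<le> 1}. C 0 \<omega> < C 1 \<omega>}"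
  let ?B = "\<lambda>q. {\<omega> \<in> {\<omega> \<in> space M. q < \<sigma> \<omega>}. C q \<omega> = C 1 \<omega>}"
  let ?D = "\<lambda>q. {\<omega> \<in> {\<omega> \<in> space M. \<sigma> \<omega> < q}. C q \<omega> \<noteq> C 1 \<omega>}"
  have A: "?A \<in> sets M" by (intro C_event) auto
  have B: "(\<Union>q\<in>\<rat> \<inter> {0..1}. ?B q \<union> ?D q) \<in> sets M"
    using Q by (intro sets.countable_UN'' sets.Un C_event) auto
  have "success_event (space M) C \<sigma> = ?A - (\<Union>q\<in>\<rat> \<inter> {0..1}. ?B q \<union> ?D q)"
  proof (rule set_eqI)
    fix \<omega>
    show "\<omega> \<in> success_event (space M) C \<sigma> \<longleftrightarrow> \<omega> \<in> ?A - (\<Union>q\<in>\<rat> \<inter> {0..1}. ?B q \<union> ?D q)"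
    proof (cases "\<omega> \<in> space M")
      case True
      show ?thesis
        using True unfolding success_rational_iff[of _ \<sigma>, OF True admissible_bounds(1)[OF adm True]]
        by blast
    qed (auto simp: success_event_def)
  qed
  then show ?thesis using sets.Diff[OF A B] by simp
qed

section \<open>Stopping before the threshold\<close>

text \<open>
  A jump at \<open>r\<close> is an arrival in \<open>(q, r]\<close> for every \<open>q < r\<close>, and for \<open>q\<close> close to \<open>r\<close> the mean number of
  such arrivals is small. Only paths with \<open>T < r\<close> are covered: a jump at \<open>T\<close> itself may have positive
  probability.
\<close>

lemma jump_at_fixed_time_null:
  assumes r: "0 < r" "r \<le> 1"
  obtains N where "N \<in> sets M" "prob N = 0"
    "{\<omega> \<in> space M. T \<omega> < r \<and> jump (\<lambda>t. C t \<omega>) r} \<subseteq> N"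
proof -
  define q where "q i = r - r / real (Suc i)" for i
  have q: "0 \<le> q i" "q i < r" for i
    using r by (auto simp: q_def field_simps)
  have q_lim: "eventually (\<lambda>i. x < q i) sequentially" if "x < r" for x
  proof -
    have "(\<lambda>i. r / real (Suc i)) \<longlonglongrightarrow> 0"
      using LIMSEQ_Suc[OF lim_const_over_n[of r]] by simp
    then have "eventually (\<lambda>i. r / real (Suc i) < r - x) sequentially"
      using that by (intro order_tendstoD(2)) auto
    then show ?thesis by (rule eventually_mono) (simp add: q_def)
  qed
  have q_mono: "q i \<le> q j" if "i \<le> j" for i j
    using that r by (auto simp: q_def intro!: divide_left_mono)
  define J where "J j = {\<omega> \<in> started (q j). C r \<omega> \<noteq> C (q j) \<omega>}" for j
  \<comment> \<open>null events that increase to a superset of the event in question\<close>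
  define E where "E i = (\<Inter>j\<in>{i..}. J j)" for i
  have J: "J j \<in> sets M" for j
    unfolding J_def using q[of j] r by (intro C_event started_M) auto
  have E: "E i \<in> sets M" for i
    unfolding E_def using J by (intro sets.countable_INT) auto
  have "prob (E i) = 0" for i
  proof (rule antisym)
    show "prob (E i) \<le> 0"
    proof (rule field_le_epsilon)
      fix e :: real assume "0 < e"
      then obtain d where d: "0 < d" "\<And>a b. 0 \<le> a \<Longrightarrow> a \<le> b \<Longrightarrow> b \<le> 1 \<Longrightarrow> b < a + d \<Longrightarrow> integral {a..b} \<eta> < e"
        using mean_small_on_short_intervals by blast
      have "eventually (\<lambda>j. i \<le> j \<and> r - d < q j) sequentially"
        using q_lim[of "r - d"] d(1) by (intro eventually_conj eventually_ge_at_top) auto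
      then obtain j where j: "i \<le> j" "r - d < q j"
        using eventually_happens'[OF sequentially_bot] by blast
      have "prob (E i) \<le> prob (J j)"
        using j(1) J by (intro finite_measure_mono) (auto simp: E_def)
      also have "\<dots> \<le> prob (started (q j)) * integral {q j..r} \<eta>"
        unfolding J_def using q[of j] r by (intro increment_prob_le) auto
      also have "\<dots> \<le> 1 * integral {q j..r} \<eta>"
        using q[of j] r by (intro mult_right_mono integral_nonneg_eta) auto
      also have "\<dots> \<le> 0 + e"
        using d(2)[of "q j" r] q[of j] j(2) r by simp
      finally show "prob (E i) \<le> 0 + e" .
    qed
  qed simp
  then have "(\<Union>i. E i) \<in> null_sets M"
    using E by (intro null_sets_UN) (auto simp: null_sets_def emeasure_eq_measure)
  moreover have "{\<omega> \<in> space M. T \<omega> < r \<and> jump (\<lambda>t. C t \<omega>) r} \<subseteq> (\<Union>i. E i)"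
  proof
    fix \<omega> assume \<omega>: "\<omega> \<in> {\<omega> \<in> space M. T \<omega> < r \<and> jump (\<lambda>t. C t \<omega>) r}"
    then obtain i where i: "T \<omega> < q i"
      using eventually_happens'[OF sequentially_bot q_lim[of "T \<omega>"]] by auto
    have "\<omega> \<in> J j" if "i \<le> j" for j
    proof -
      have "C (q j) \<omega> < C r \<omega>" using \<omega> q[of j] by (auto simp: jump_def)
      then show ?thesis using \<omega> i q_mono[OF that] by (auto simp: J_def)
    qed
    then show "\<omega> \<in> (\<Union>i. E i)" by (auto simp: E_def)
  qed
  ultimately show ?thesis
    using that by (auto simp: null_sets_def emeasure_eq_measure)
qed

text \<open>
  A success of \<open>\<sigma>\<close> before the threshold leaves no arrival after the threshold. Given \<open>\<sigma> < threshold\<close>, this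
  is as likely as exactly one arrival after the threshold, which the first selectable arrival catches.
\<close>

lemma stopping_before_threshold_no_gain:
  assumes adm: "admissible_strategy F (space M) T \<sigma>"
  shows "prob {\<omega> \<in> success_event (space M) C \<sigma>. \<sigma> \<omega> < threshold}
    \<le> prob {\<omega> \<in> success_event (space M) C first_selectable. \<sigma> \<omega> < threshold}"
proof (cases "threshold = 0")
  case True
  have "{\<omega> \<in> success_event (space M) C \<sigma>. \<sigma> \<omega> < threshold} = {}"
    using admissible_bounds(1)[OF adm] True by (force simp: success_event_def)
  then show ?thesis by (metis measure_empty measure_nonneg)
next
  case False
  define r where "r = threshold"
  have r: "0 < r" "r \<le> 1" using threshold_range False by (auto simp: r_def)
  define A where "A = {\<omega> \<in> space M. \<sigma> \<omega> < r}"
  have A: "A \<in> sets (F r)" unfolding A_def by (rule stopped_before_event[OF adm])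
  have T_before: "T \<omega> < r" if "\<omega> \<in> A" for \<omega>
    using admissible_bounds(2)[OF adm, of \<omega>] that by (auto simp: A_def)
  then have sub: "A \<subseteq> started r" by (force simp: A_def)
  have AM: "A \<in> sets M" using A sets_F by blast
  have win: "success_event (space M) C first_selectable \<in> sets M"
    by (rule success_event_measurable[OF admissible_first_selectable])
  define W where "W = {\<omega> \<in> success_event (space M) C first_selectable. \<sigma> \<omega> < r}"
  have "W = success_event (space M) C first_selectable \<inter> A"
    by (auto simp: W_def A_def success_event_def)
  then have W: "W \<in> sets M" using win AM by simp
  obtain N where N: "N \<in> sets M" "prob N = 0"
    "{\<omega> \<in> space M. T \<omega> < r \<and> jump (\<lambda>t. C t \<omega>) r} \<subseteq> N"
    using jump_at_fixed_time_null[OF r] by blast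
  have one: "{\<omega> \<in> A. C 1 \<omega> = C r \<omega> + 1} \<subseteq> W \<union> N"
  proof
    fix \<omega> assume "\<omega> \<in> {\<omega> \<in> A. C 1 \<omega> = C r \<omega> + 1}"
    then have \<omega>: "\<omega> \<in> space M" "\<omega> \<in> A" "C 1 \<omega> = C r \<omega> + 1" by (auto simp: A_def)
    interpret c: counting_path "\<lambda>t. C t \<omega>" by (rule path[OF \<omega>(1)])
    obtain L where L: "jump (\<lambda>t. C t \<omega>) L" "C L \<omega> = C 1 \<omega>"
      using c.last_jump_exists \<omega>(3) by auto
    have rL: "r < L" using c.jump_le_iff[OF L(1), of r] r L(2) \<omega>(3) by auto
    note \<tau> = first_selectable_least[OF \<omega>(1) L(1)]
    show "\<omega> \<in> W \<union> N"
    proof (cases "jump (\<lambda>t. C t \<omega>) r")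
      case True
      then show ?thesis using N(3) T_before[OF \<omega>(2)] \<omega>(1) by blast
    next
      case False
      let ?\<tau> = "first_selectable \<omega>"
      have \<tau>': "jump (\<lambda>t. C t \<omega>) ?\<tau>" "r < ?\<tau>" "?\<tau> \<le> L"
        using \<tau> rL T_before[OF \<omega>(2)] False unfolding r_def[symmetric] by (force simp: less_le)+
      then have "C r \<omega> < C ?\<tau> \<omega>" "C ?\<tau> \<omega> \<le> C 1 \<omega>"
        using c.jump_less[of ?\<tau> r] c.le[of ?\<tau> 1] r by (auto simp: jump_def)
      then have "C ?\<tau> \<omega> = C 1 \<omega>" using \<omega>(3) by simp
      then show ?thesis
        using success_iff[OF \<omega>(1)] \<tau>'(1) \<omega>(2) by (auto simp: W_def A_def)
    qed
  qed
  have "{\<omega> \<in> success_event (space M) C \<sigma>. \<sigma> \<omega> < r} \<subseteq> {\<omega> \<in> A. C 1 \<omega> = C r \<omega>}"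
  proof
    fix \<omega> assume h: "\<omega> \<in> {\<omega> \<in> success_event (space M) C \<sigma>. \<sigma> \<omega> < r}"
    then have \<omega>: "\<omega> \<in> space M" by (auto simp: success_event_def)
    interpret c: counting_path "\<lambda>t. C t \<omega>" by (rule path[OF \<omega>])
    have "jump (\<lambda>t. C t \<omega>) (\<sigma> \<omega>)" "C (\<sigma> \<omega>) \<omega> = C 1 \<omega>"
      using h success_iff[OF \<omega>] by auto
    then have "C 1 \<omega> = C r \<omega>"
      using c.le[of "\<sigma> \<omega>" r] c.le[of r 1] h r by (auto simp: jump_def)
    then show "\<omega> \<in> {\<omega> \<in> A. C 1 \<omega> = C r \<omega>}" using h \<omega> by (auto simp: A_def)
  qed
  then have "prob {\<omega> \<in> success_event (space M) C \<sigma>. \<sigma> \<omega> < r} \<le> prob {\<omega> \<in> A. C 1 \<omega> = C r \<omega>}"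
    using r AM by (intro finite_measure_mono C_event) auto
  also have "\<dots> = prob {\<omega> \<in> A. C 1 \<omega> = C r \<omega> + 1}"
    using one_arrival_vs_none[OF A sub] mean_after_threshold r by (simp add: r_def)
  also have "\<dots> \<le> prob (W \<union> N)"
    using one W N(1) by (intro finite_measure_mono) auto
  also have "\<dots> \<le> prob W"
    using measure_Un_le[OF W N(1)] N(2) by simp
  finally show ?thesis by (simp add: W_def r_def)
qed

section \<open>Skipping arrivals after the threshold\<close>

text \<open>
  Levels count arrivals, so that \<open>C K \<omega> + j = C 1 \<omega>\<close> singles out the arrival \<open>K\<close> followed by exactly
  \<open>j\<close> others: the last one for \<open>j = 0\<close>, the next-to-last one for \<open>j = 1\<close>.
\<close>

definition skipped :: "('a \<Rightarrow> real) \<Rightarrow> nat \<Rightarrow> 'a set" where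
  "skipped \<sigma> j = {\<omega> \<in> space M. \<exists>K. jump (\<lambda>t. C t \<omega>) K \<and> C K \<omega> + j = C 1 \<omega> \<and>
     first_selectable \<omega> \<le> K \<and> K < \<sigma> \<omega>}"

text \<open>
  Both stopping times are compared with the end of the cell only, which keeps the event in the history
  at that time. Some arrivals of the cell may precede the first selectable one; the last arrival
  of the cell does not, and it is skipped (\<open>skipped_grid_subset\<close>).
\<close>

definition skipped_cell :: "('a \<Rightarrow> real) \<Rightarrow> nat \<Rightarrow> nat \<Rightarrow> 'a set" where
  "skipped_cell \<sigma> n k = {\<omega> \<in> space M. first_selectable \<omega> \<le> grid 0 n (Suc k) \<and>
     grid 0 n (Suc k) < \<sigma> \<omega> \<and> C (grid 0 n k) \<omega> < C (grid 0 n (Suc k)) \<omega>}"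

definition skipped_grid :: "('a \<Rightarrow> real) \<Rightarrow> nat \<Rightarrow> nat \<Rightarrow> 'a set" where
  "skipped_grid \<sigma> j n =
     (\<Union>k\<in>{..<n}. {\<omega> \<in> skipped_cell \<sigma> n k. C 1 \<omega> = C (grid 0 n (Suc k)) \<omega> + j})"

lemma grid_facts:
  assumes "k < n"
  shows "0 \<le> grid 0 n k" "grid 0 n k < grid 0 n (Suc k)" "grid 0 n (Suc k) \<le> 1"
  using assms grid_bounds[of 0 n k] grid_bounds[of 0 n "Suc k"] grid_step[of n 0 k] by auto

lemma skipped_cell_F:
  assumes adm: "admissible_strategy F (space M) T \<sigma>" and k: "k < n"
  shows "skipped_cell \<sigma> n k \<in> sets (F (grid 0 n (Suc k)))"
    "skipped_cell \<sigma> n k \<subseteq> started (grid 0 n (Suc k))"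
    "skipped_cell \<sigma> n k \<noteq> {} \<Longrightarrow> threshold \<le> grid 0 n (Suc k)"
proof -
  let ?v = "grid 0 n (Suc k)"
  have "{\<omega> \<in> space M. first_selectable \<omega> \<le> ?v} \<in> sets (F ?v)"
    by (rule stopped_by[OF stopping_first_selectable order_refl])
  moreover have "{\<omega> \<in> space M. \<sigma> \<omega> \<le> ?v} \<in> sets (F ?v)"
    using adm by (intro stopped_by) (auto simp: admissible_strategy_def)
  ultimately have "{\<omega> \<in> space M. first_selectable \<omega> \<le> ?v} - {\<omega> \<in> space M. \<sigma> \<omega> \<le> ?v} \<in> sets (F ?v)"
    by (rule sets.Diff)
  then have "{\<omega> \<in> {\<omega> \<in> space M. first_selectable \<omega> \<le> ?v} - {\<omega> \<in> space M. \<sigma> \<omega> \<le> ?v}.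
      C (grid 0 n k) \<omega> < C ?v \<omega>} \<in> sets (F ?v)"
    using grid_facts[OF k] by (intro C_event_F) auto
  also have "{\<omega> \<in> {\<omega> \<in> space M. first_selectable \<omega> \<le> ?v} - {\<omega> \<in> space M. \<sigma> \<omega> \<le> ?v}.
      C (grid 0 n k) \<omega> < C ?v \<omega>} = skipped_cell \<sigma> n k"
    by (auto simp: skipped_cell_def)
  finally show "skipped_cell \<sigma> n k \<in> sets (F ?v)" .
  have "T \<omega> \<le> ?v \<and> threshold \<le> ?v" if "\<omega> \<in> skipped_cell \<sigma> n k" for \<omega>
    using first_selectable_stops[of \<omega>] that grid_facts[OF k] by (force simp: skipped_cell_def)
  then show "skipped_cell \<sigma> n k \<subseteq> started ?v" "skipped_cell \<sigma> n k \<noteq> {} \<Longrightarrow> threshold \<le> ?v"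
    by (auto simp: skipped_cell_def)
qed

lemma skipped_cell_event:
  assumes "admissible_strategy F (space M) T \<sigma>" "k < n"
  shows "{\<omega> \<in> skipped_cell \<sigma> n k. C 1 \<omega> = C (grid 0 n (Suc k)) \<omega> + j} \<in> sets M"
  using skipped_cell_F(1)[OF assms] grid_facts[OF assms(2)] sets_F by (intro C_event) auto

text \<open>
  Of two cells that contain an arrival, the end of the later one is followed by fewer arrivals, so the
  events that belong to different cells are disjoint.
\<close>

lemma prob_skipped_grid:
  assumes adm: "admissible_strategy F (space M) T \<sigma>"
  shows "prob (skipped_grid \<sigma> j n)
    = (\<Sum>k<n. prob {\<omega> \<in> skipped_cell \<sigma> n k. C 1 \<omega> = C (grid 0 n (Suc k)) \<omega> + j})"
  unfolding skipped_grid_def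
proof (rule finite_measure_finite_Union)
  let ?D = "\<lambda>k. {\<omega> \<in> skipped_cell \<sigma> n k. C 1 \<omega> = C (grid 0 n (Suc k)) \<omega> + j}"
  show "?D ` {..<n} \<subseteq> sets M" using skipped_cell_event[OF adm] by blast
  have disj: "?D k \<inter> ?D l = {}" if "k < l" "l < n" for k l
  proof (rule ccontr)
    assume "\<not> ?thesis"
    then obtain \<omega> where \<omega>: "\<omega> \<in> ?D k" "\<omega> \<in> ?D l" by blast
    then have "\<omega> \<in> space M" by (simp add: skipped_cell_def)
    then interpret c: counting_path "\<lambda>t. C t \<omega>" by (rule path)
    have "C (grid 0 n (Suc k)) \<omega> \<le> C (grid 0 n l) \<omega>" using that by (intro c.grid_le) auto
    then show False using \<omega> by (auto simp: skipped_cell_def)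
  qed
  show "disjoint_family_on ?D {..<n}"
    unfolding disjoint_family_on_def
  proof (intro ballI impI)
    fix k l assume "k \<in> {..<n}" "l \<in> {..<n}" "k \<noteq> l"
    then show "?D k \<inter> ?D l = {}" using disj[of k l] disj[of l k] by (cases "k < l") auto
  qed
qed simp

lemma skipped_grid_event:
  "admissible_strategy F (space M) T \<sigma> \<Longrightarrow> skipped_grid \<sigma> j n \<in> sets M"
  unfolding skipped_grid_def using skipped_cell_event by (intro sets.finite_UN) auto

text \<open>
  At the end of each cell that contributes, the expected number of remaining arrivals is at most one,
  so that exactly one further arrival is at most as likely as none.
\<close>

lemma prob_skipped_grid_le:
  assumes adm: "admissible_strategy F (space M) T \<sigma>"
  shows "prob (skipped_grid \<sigma> 1 n) \<le> prob (skipped_grid \<sigma> 0 n)"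
  unfolding prob_skipped_grid[OF adm]
proof (rule sum_mono)
  fix k assume "k \<in> {..<n}"
  then have k: "k < n" by simp
  let ?B = "skipped_cell \<sigma> n k" and ?v = "grid 0 n (Suc k)"
  show "prob {\<omega> \<in> ?B. C 1 \<omega> = C ?v \<omega> + 1} \<le> prob {\<omega> \<in> ?B. C 1 \<omega> = C ?v \<omega> + 0}"
  proof (cases "?B = {}")
    case False
    then have "mean_after ?v \<le> 1"
      using skipped_cell_F(3)[OF adm k] mean_after_le_one_iff[of ?v] grid_facts[OF k] by simp
    moreover have "prob {\<omega> \<in> ?B. C 1 \<omega> = C ?v \<omega> + 1} = mean_after ?v * prob {\<omega> \<in> ?B. C 1 \<omega> = C ?v \<omega>}"
      using grid_facts[OF k] by (intro one_arrival_vs_none skipped_cell_F[OF adm k]) auto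
    moreover have "0 \<le> mean_after ?v" using grid_facts[OF k] by (intro integral_nonneg_eta) auto
    ultimately show ?thesis by (simp add: mult_left_le_one_le)
  qed simp
qed

text \<open>
  The arrival at which the path reaches its value at the end of the cell is the skipped one: the first
  selectable arrival is not after it, because its level is not higher.
\<close>

lemma skipped_grid_subset: "skipped_grid \<sigma> j n \<subseteq> skipped \<sigma> j"
proof
  fix \<omega> assume "\<omega> \<in> skipped_grid \<sigma> j n"
  then obtain k where k: "k < n" and cell: "\<omega> \<in> skipped_cell \<sigma> n k"
    and eq: "C 1 \<omega> = C (grid 0 n (Suc k)) \<omega> + j"
    by (auto simp: skipped_grid_def)
  let ?v = "grid 0 n (Suc k)" and ?\<tau> = "first_selectable \<omega>"
  have \<omega>: "\<omega> \<in> space M" "?\<tau> \<le> ?v" "?v < \<sigma> \<omega>" "C (grid 0 n k) \<omega> < C ?v \<omega>"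
    using cell by (auto simp: skipped_cell_def)
  interpret c: counting_path "\<lambda>t. C t \<omega>" by (rule path[OF \<omega>(1)])
  obtain K where K: "K \<le> ?v" "jump (\<lambda>t. C t \<omega>) K" "C K \<omega> = C ?v \<omega>"
    using c.level_reached_by_jump[of "grid 0 n k" ?v "C ?v \<omega>"] grid_facts[OF k] \<omega>(4) by auto
  have \<tau>: "jump (\<lambda>t. C t \<omega>) ?\<tau>"
    using first_selectable_stops(1)[OF \<omega>(1)] \<omega>(2) grid_facts[OF k] by simp
  have "C ?\<tau> \<omega> \<le> C K \<omega>"
    using c.le[of ?\<tau> ?v] \<tau> \<omega>(2) K(3) grid_facts[OF k] by (simp add: jump_def)
  then have "?\<tau> \<le> K" using c.jump_le_iff[OF \<tau>, of K] K(2) by (simp add: jump_def)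
  then show "\<omega> \<in> skipped \<sigma> j"
    using K eq \<omega> by (auto simp: skipped_def intro!: exI[of _ K])
qed

text \<open>
  Once the mesh is smaller than the distances from \<open>K\<close> to the next arrival and to \<open>\<sigma>\<close>, the cell that
  contains \<open>K\<close> is a witness.
\<close>

lemma eventually_skipped_grid:
  assumes "\<omega> \<in> skipped \<sigma> j"
  shows "eventually (\<lambda>n. \<omega> \<in> skipped_grid \<sigma> j n) sequentially"
proof -
  let ?\<tau> = "first_selectable \<omega>"
  obtain K where \<omega>: "\<omega> \<in> space M" and K: "jump (\<lambda>t. C t \<omega>) K" "C K \<omega> + j = C 1 \<omega>"
    "?\<tau> \<le> K" "K < \<sigma> \<omega>"
    using assms by (auto simp: skipped_def)
  interpret c: counting_path "\<lambda>t. C t \<omega>" by (rule path[OF \<omega>])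
  have K01: "0 < K" "K \<le> 1" using K(1) by (auto simp: jump_def)
  obtain d where d: "0 < d" "\<And>u. K \<le> u \<Longrightarrow> u < K + d \<Longrightarrow> u \<le> 1 \<Longrightarrow> C u \<omega> = C K \<omega>"
  proof (cases "K = 1")
    case True then show ?thesis by (intro that[of 1]) auto
  next
    case False then show ?thesis
      using c.right_constant[of K] K01 that by (metis less_eq_real_def)
  qed
  have "eventually (\<lambda>n. 1 / real n < min d (\<sigma> \<omega> - K)) sequentially"
    using d(1) K(4) by (intro order_tendstoD(2)[OF lim_const_over_n]) auto
  moreover have "eventually (\<lambda>n::nat. 0 < n) sequentially" by (rule eventually_gt_at_top)
  ultimately show ?thesis
  proof eventually_elim
    case (elim n)
    \<comment> \<open>the cell containing \<open>K\<close>; cells are closed on the right\<close>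
    define k where "k = nat (\<lceil>K * real n\<rceil> - 1)"
    have "0 < K * real n" "K * real n \<le> real n" using K01 elim by auto
    then have "1 \<le> \<lceil>K * real n\<rceil>" "\<lceil>K * real n\<rceil> \<le> int n" by linarith+
    then have kk: "k < n" "real k < K * real n" "K * real n \<le> real (Suc k)"
      unfolding k_def by linarith+
    let ?u = "grid 0 n k" and ?v = "grid 0 n (Suc k)"
    have u: "?u < K" and v: "K \<le> ?v" using kk elim by (auto simp: grid_def field_simps)
    have step: "?v = ?u + 1 / real n" using grid_step[of n 0 k] elim by simp
    have "C ?v \<omega> = C K \<omega>" using u v step elim grid_facts[OF kk(1)] by (intro d(2)) auto
    moreover have "C ?u \<omega> < C K \<omega>" using c.jump_less[OF K(1), of ?u] u grid_facts[OF kk(1)] by simp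
    moreover have "?v < \<sigma> \<omega>" using u step elim by simp
    ultimately have "\<omega> \<in> skipped_cell \<sigma> n k" "C 1 \<omega> = C ?v \<omega> + j"
      using \<omega> K v by (auto simp: skipped_cell_def)
    then show ?case using kk(1) by (auto simp: skipped_grid_def)
  qed
qed

lemma skipped_event:
  assumes "admissible_strategy F (space M) T \<sigma>"
  shows "skipped \<sigma> j \<in> sets M"
proof -
  have "skipped \<sigma> j = (\<Union>n. skipped_grid \<sigma> j n)"
  proof
    show "(\<Union>n. skipped_grid \<sigma> j n) \<subseteq> skipped \<sigma> j" using skipped_grid_subset by (rule UN_least)
    show "skipped \<sigma> j \<subseteq> (\<Union>n. skipped_grid \<sigma> j n)"
    proof
      fix \<omega> assume "\<omega> \<in> skipped \<sigma> j"
      then obtain n where "\<omega> \<in> skipped_grid \<sigma> j n"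
        using eventually_happens'[OF sequentially_bot eventually_skipped_grid] by blast
      then show "\<omega> \<in> (\<Union>n. skipped_grid \<sigma> j n)" by blast
    qed
  qed
  also have "\<dots> \<in> sets M" using skipped_grid_event[OF assms] by (intro sets.countable_UN) auto
  finally show ?thesis .
qed

text \<open>
  The grid events are contained in their limit and contain each of its points from some mesh on, but
  they are not monotone in the mesh; the increasing events \<open>W n\<close> pass the inequality to the limit.
\<close>

lemma prob_skipped_le:
  assumes adm: "admissible_strategy F (space M) T \<sigma>"
  shows "prob (skipped \<sigma> 1) \<le> prob (skipped \<sigma> 0)"
proof -
  define W where "W n = (\<Inter>m\<in>{n..}. skipped_grid \<sigma> 1 m)" for n
  have W: "W n \<in> sets M" for n
    unfolding W_def using skipped_grid_event[OF adm] by (intro sets.countable_INT) auto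
  have "(\<Union>n. W n) = skipped \<sigma> 1"
  proof
    show "(\<Union>n. W n) \<subseteq> skipped \<sigma> 1"
      using skipped_grid_subset by (fastforce simp: W_def)
    show "skipped \<sigma> 1 \<subseteq> (\<Union>n. W n)"
    proof
      fix \<omega> assume "\<omega> \<in> skipped \<sigma> 1"
      from eventually_skipped_grid[OF this]
      obtain n where "\<forall>m\<ge>n. \<omega> \<in> skipped_grid \<sigma> 1 m" unfolding eventually_sequentially by blast
      then show "\<omega> \<in> (\<Union>n. W n)" by (auto simp: W_def)
    qed
  qed
  moreover have "incseq W" by (auto simp: incseq_def W_def)
  ultimately have "(\<lambda>n. prob (W n)) \<longlonglongrightarrow> prob (skipped \<sigma> 1)"
    using finite_Lim_measure_incseq[of W] W by auto
  moreover have "prob (W n) \<le> prob (skipped \<sigma> 0)" for n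
  proof -
    have "prob (W n) \<le> prob (skipped_grid \<sigma> 1 n)"
      using skipped_grid_event[OF adm] by (intro finite_measure_mono) (auto simp: W_def)
    also have "\<dots> \<le> prob (skipped_grid \<sigma> 0 n)" by (rule prob_skipped_grid_le[OF adm])
    also have "\<dots> \<le> prob (skipped \<sigma> 0)"
      by (rule finite_measure_mono[OF skipped_grid_subset skipped_event[OF adm]])
    finally show ?thesis .
  qed
  ultimately show ?thesis by (intro LIMSEQ_le_const2) auto
qed

text \<open>
  The first selectable arrival lies before \<open>\<sigma>\<close>, the last arrival. Then it is not
  after the next-to-last arrival, which is therefore skipped, whereas the last one is taken.
\<close>

lemma success_after_threshold_cases:
  assumes h: "\<omega> \<in> success_event (space M) C \<sigma>" "T \<omega> \<le> \<sigma> \<omega>" "threshold \<le> \<sigma> \<omega>"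
    and ne: "\<sigma> \<omega> \<noteq> first_selectable \<omega>"
  shows "\<omega> \<in> skipped \<sigma> 1 - skipped \<sigma> 0"
proof -
  have \<omega>: "\<omega> \<in> space M" using h(1) by (simp add: success_event_def)
  interpret c: counting_path "\<lambda>t. C t \<omega>" by (rule path[OF \<omega>])
  let ?\<tau> = "first_selectable \<omega>"
  have \<sigma>: "jump (\<lambda>t. C t \<omega>) (\<sigma> \<omega>)" "C (\<sigma> \<omega>) \<omega> = C 1 \<omega>"
    using h(1) success_iff[OF \<omega>] by auto
  have \<tau>: "jump (\<lambda>t. C t \<omega>) ?\<tau>" "?\<tau> < \<sigma> \<omega>"
    using first_selectable_least[OF \<omega> \<sigma>(1) h(2,3)] ne by auto
  have less: "C ?\<tau> \<omega> < C 1 \<omega>" using c.jump_less[OF \<sigma>(1), of ?\<tau>] \<tau> \<sigma>(2) by (simp add: jump_def)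
  have "0 < ?\<tau>" using \<tau>(1) by (simp add: jump_def)
  then have "0 < C 1 \<omega> - 1" using c.jump_less[OF \<tau>(1), of 0] less by simp
  then obtain K where K: "jump (\<lambda>t. C t \<omega>) K" "C K \<omega> = C 1 \<omega> - 1"
    using c.level_reached_by_jump[of 0 1 "C 1 \<omega> - 1"] c.zero by auto
  have "?\<tau> \<le> K" "\<not> \<sigma> \<omega> \<le> K"
    using c.jump_le_iff[OF \<tau>(1), of K] c.jump_le_iff[OF \<sigma>(1), of K] K less \<sigma>(2)
    by (auto simp: jump_def)
  then have "\<omega> \<in> skipped \<sigma> 1" using \<omega> K less by (auto simp: skipped_def intro!: exI[of _ K])
  moreover have "\<omega> \<notin> skipped \<sigma> 0"
    using c.jump_eq_iff[OF _ \<sigma>(1)] \<sigma>(2) by (auto simp: skipped_def)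
  ultimately show ?thesis by simp
qed

text \<open>
  If the first selectable arrival were not the last, the next-to-last arrival would be skipped as well.
\<close>

lemma skipped_last_imp_success:
  assumes "\<omega> \<in> skipped \<sigma> 0 - skipped \<sigma> 1"
  shows "\<omega> \<in> success_event (space M) C first_selectable" "first_selectable \<omega> < \<sigma> \<omega>"
proof -
  let ?\<tau> = "first_selectable \<omega>"
  obtain L where \<omega>: "\<omega> \<in> space M" and L: "jump (\<lambda>t. C t \<omega>) L" "C L \<omega> = C 1 \<omega>"
    "?\<tau> \<le> L" "L < \<sigma> \<omega>"
    using assms by (auto simp: skipped_def)
  interpret c: counting_path "\<lambda>t. C t \<omega>" by (rule path[OF \<omega>])
  have \<tau>: "jump (\<lambda>t. C t \<omega>) ?\<tau>"
    using first_selectable_stops(1)[OF \<omega>] L by (simp add: jump_def)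
  have "C ?\<tau> \<omega> = C 1 \<omega>"
  proof (rule ccontr)
    assume "C ?\<tau> \<omega> \<noteq> C 1 \<omega>"
    then have less: "C ?\<tau> \<omega> < C 1 \<omega>" using c.le[of ?\<tau> 1] \<tau> by (simp add: jump_def)
    have "0 < ?\<tau>" using \<tau> by (simp add: jump_def)
    then have "0 < C 1 \<omega> - 1" using c.jump_less[OF \<tau>, of 0] less by simp
    then obtain K where K: "jump (\<lambda>t. C t \<omega>) K" "C K \<omega> = C 1 \<omega> - 1"
      using c.level_reached_by_jump[of 0 1 "C 1 \<omega> - 1"] c.zero by auto
    have "?\<tau> \<le> K" "\<not> L \<le> K"
      using c.jump_le_iff[OF \<tau>, of K] c.jump_le_iff[OF L(1), of K] K less L(2)
      by (auto simp: jump_def)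
    then have "\<omega> \<in> skipped \<sigma> 1"
      using \<omega> K less L(4) by (auto simp: skipped_def intro!: exI[of _ K])
    then show False using assms by simp
  qed
  then show "\<omega> \<in> success_event (space M) C first_selectable" "?\<tau> < \<sigma> \<omega>"
    using success_iff[OF \<omega>] \<tau> L by auto
qed

section \<open>Optimality\<close>

text \<open>
  The wins of \<open>\<sigma>\<close> fall into three parts, before the threshold (\<open>Xa\<close>), together with the first
  selectable arrival (\<open>Yb\<close>), and after it. They are bounded by three disjoint parts \<open>Ya\<close>, \<open>Yb\<close>, \<open>Yc\<close>
  of the wins of the first selectable arrival.
\<close>

lemma success_prob_le:
  assumes adm: "admissible_strategy F (space M) T \<sigma>"
  shows "prob (success_event (space M) C \<sigma>) \<le> prob (success_event (space M) C first_selectable)"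
proof -
  let ?S = "success_event (space M) C \<sigma>" and ?W = "success_event (space M) C first_selectable"
  have S: "?S \<in> sets M" by (rule success_event_measurable[OF adm])
  have W: "?W \<in> sets M" by (rule success_event_measurable[OF admissible_first_selectable])
  note [measurable] = admissible_measurable[OF adm] admissible_measurable[OF admissible_first_selectable]
  have spaceS: "?S \<subseteq> space M" "?W \<subseteq> space M" by (auto simp: success_event_def)
  have cut: "{\<omega> \<in> A. P \<omega>} \<in> sets M" if "A \<in> sets M" "{\<omega> \<in> space M. P \<omega>} \<in> sets M" for A P
  proof -
    have "{\<omega> \<in> A. P \<omega>} = A \<inter> {\<omega> \<in> space M. P \<omega>}" using sets.sets_into_space[OF that(1)] by auto
    then show ?thesis using that by simp
  qed
  define Xa where "Xa = {\<omega> \<in> ?S. \<sigma> \<omega> < threshold}"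
  define Ya where "Ya = {\<omega> \<in> ?W. \<sigma> \<omega> < threshold}"
  define Yb where "Yb = {\<omega> \<in> ?W. \<sigma> \<omega> = first_selectable \<omega>}"
  define Yc where "Yc = {\<omega> \<in> ?W. first_selectable \<omega> < \<sigma> \<omega>}"
  have meas: "Xa \<in> sets M" "Ya \<in> sets M" "Yb \<in> sets M" "Yc \<in> sets M"
  proof -
    have ev: "{\<omega> \<in> space M. \<sigma> \<omega> < threshold} \<in> sets M"
      "{\<omega> \<in> space M. \<sigma> \<omega> = first_selectable \<omega>} \<in> sets M"
      "{\<omega> \<in> space M. first_selectable \<omega> < \<sigma> \<omega>} \<in> sets M"
      by measurable
    show "Xa \<in> sets M" "Ya \<in> sets M" "Yb \<in> sets M" "Yc \<in> sets M"
      unfolding Xa_def Ya_def Yb_def Yc_def by (rule cut[OF S ev(1)] cut[OF W ev(1)] cut[OF W ev(2)] cut[OF W ev(3)])+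
  qed
  note U = skipped_event[OF adm]
  have cover: "?S \<subseteq> Xa \<union> (Yb \<union> (skipped \<sigma> 1 - skipped \<sigma> 0))"
  proof
    fix \<omega> assume \<omega>: "\<omega> \<in> ?S"
    then have sp: "\<omega> \<in> space M" using spaceS by blast
    show "\<omega> \<in> Xa \<union> (Yb \<union> (skipped \<sigma> 1 - skipped \<sigma> 0))"
    proof (cases "\<sigma> \<omega> < threshold")
      case True
      then show ?thesis using \<omega> by (simp add: Xa_def)
    next
      case False
      show ?thesis
      proof (cases "\<sigma> \<omega> = first_selectable \<omega>")
        case True
        then show ?thesis using \<omega> success_iff[OF sp] by (simp add: Yb_def)
      next
        case neq: False
        then show ?thesis
          using success_after_threshold_cases[OF \<omega> admissible_bounds(2)[OF adm sp]] False by simp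
      qed
    qed
  qed
  have late: "threshold \<le> first_selectable \<omega>" if "\<omega> \<in> ?W" for \<omega>
    using that first_selectable_stops(3)[of \<omega>] success_iff[of \<omega> first_selectable] spaceS
    by (auto simp: jump_def)
  have "prob ?S \<le> prob (Xa \<union> (Yb \<union> (skipped \<sigma> 1 - skipped \<sigma> 0)))"
    using meas U by (intro finite_measure_mono[OF cover] sets.Un sets.Diff)
  also have "\<dots> \<le> prob Xa + (prob Yb + prob (skipped \<sigma> 1 - skipped \<sigma> 0))"
    using meas U measure_Un_le[of Xa M "Yb \<union> (skipped \<sigma> 1 - skipped \<sigma> 0)"]
      measure_Un_le[of Yb M "skipped \<sigma> 1 - skipped \<sigma> 0"] by auto
  also have "prob (skipped \<sigma> 1 - skipped \<sigma> 0) \<le> prob (skipped \<sigma> 0 - skipped \<sigma> 1)"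
    using prob_skipped_le[OF adm] U
    by (simp add: finite_measure_Diff' Int_commute)
  also have "prob (skipped \<sigma> 0 - skipped \<sigma> 1) \<le> prob Yc"
    using skipped_last_imp_success meas by (intro finite_measure_mono) (auto simp: Yc_def)
  also have "prob Xa \<le> prob Ya"
    unfolding Xa_def Ya_def by (rule stopping_before_threshold_no_gain[OF adm])
  also have "prob Ya + (prob Yb + prob Yc) = prob (Ya \<union> (Yb \<union> Yc))"
  proof -
    have "Yb \<inter> Yc = {}" by (auto simp: Yb_def Yc_def)
    moreover have "Ya \<inter> (Yb \<union> Yc) = {}"
      using late by (force simp: Ya_def Yb_def Yc_def)
    ultimately show ?thesis using meas by (simp add: finite_measure_Union)
  qed
  also have "\<dots> \<le> prob ?W"
    using W by (intro finite_measure_mono) (auto simp: Ya_def Yb_def Yc_def)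
  finally show ?thesis by simp
qed

lemma first_selectable_optimal: "optimal_strategy M F C T first_selectable"
  unfolding optimal_strategy_def
  using admissible_first_selectable success_event_measurable success_prob_le by blast

end

theorem theorem2p5:
  fixes M :: "'a measure" and F :: "real \<Rightarrow> 'a measure"
    and C :: "real \<Rightarrow> 'a \<Rightarrow> nat" and T :: "'a \<Rightarrow> real" and \<eta> :: "real \<Rightarrow> real"
  assumes "prob_space M"
    and "filtration (space M) F" and "\<And>t. sets (F t) \<subseteq> sets M"
    and "counting_process F (space M) C"
    and "stopping_time F T" and "\<And>\<omega>. \<omega> \<in> space M \<Longrightarrow> T \<omega> \<in> {0..1}"
    and "confined_independent_increments M F C T"
    and "confined_intensity M C T \<eta>"
    and "Riemann_integrable_on \<eta> 0 1"
    and "integrable M (\<lambda>\<omega>. real (C 1 \<omega>))"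
  shows "optimal_strategy M F C T (first_selectable_arrival C T \<eta>)"
proof -
  interpret last_arrival_problem M F C T \<eta>
    using assms by (intro last_arrival_problem.intro last_arrival_problem_axioms.intro)
  show ?thesis by (rule first_selectable_optimal)
qed

end
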